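(* Suppose there are constants $L_B>0$ and $\mu_B>0$, where without loss of generality $\mu_B\le 2$, such that for the iterates $\alpha^t$ and matrices $B_t=a_1^t\tilde H_{\alpha^t}+a_2^tI$ of the block-diagonal approximation method described in the context: (a) for all $t$, $G^*(\alpha)\le G^*(\alpha^t)+\nabla G^*(\alpha^t)^T(\alpha-\alpha^t)+\frac{L_B}{2}\|\alpha-\alpha^t\|_{B_t}^2$ for all $\alpha\in\Omega$ close enough to $\alpha^t$; (b) $f(\alpha)-f^*\ge\frac{\mu_B}{2}\min_{\alpha^*\in A}\|\alpha-\alpha^*\|_{B_t}^2$ for all $t$ and all $\alpha\in\Omega$, where $A$ is the solution set of the dual problem. Suppose also that at every iteration the sub-problem is formed with this $B_t$ and is solved at least $\gamma$-approximately for some $\gamma\in[0,1)$, and that $\beta,\tau\in(0,1)$. Then the sequence of dual objective values generated by the method converges Q-linearly to the optimum, with the rate being $$\frac{f(\alpha^{t+1})-f^*}{f(\alpha^t)-f^*}\le 1-\frac{\tau\mu_B(1-\gamma)\eta_t}{4}\le 1-\frac{\tau\mu_B}{2}\min\left\{\frac{1-\gamma}{2},\frac{\beta(1-\tau)(1-\sqrt\gamma)}{L_B}\right\}.$$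
   Context: Problem. Let $l,n\ge1$, $c_i\ge 1$, $X_i\in\mathbb{R}^{n\times c_i}$ for $i=1,\dots,l$, $N=\sum_i c_i$, $X=[X_1,\dots,X_l]\in\mathbb{R}^{n\times N}$. The primal problem is $\min_{w\in\mathbb{R}^n} f^P(w):=g(w)+\sum_{i=1}^l\xi_i(X_i^Tw)$, where $g$ (possibly extended-valued) is $\sigma$-strongly convex for some $\sigma>0$, each $\xi_i$ is convex, $f^P$ is proper, closed and convex, and the primal solution set is nonempty. Write $\xi(z)=\sum_{i}\xi_i(z_i)$ for $z=(z_1,\dots,z_l)\in\mathbb{R}^N$, $z_i\in\mathbb{R}^{c_i}$. For a function $h$, $h^*(u)=\sup_{z\in\mathrm{dom}(h)} z^Tu-h(z)$ is its convex conjugate, so $\xi^*(-\alpha)=\sum_i\xi_i^*(-\alpha_i)$. The dual problem is $\min_{\alpha\in\Omega} f(\alpha):=G^*(\alpha)+\xi^*(-\alpha)$, where $G^*(\alpha):=g^*(X\alpha)$ and $\Omega=\prod_{i=1}^l -\mathrm{dom}(\xi_i^* )\subseteq\mathbb{R}^N$; $f^*$ is its optimal value. ($g^*$ is finite and differentiable with $(1/\sigma)$-Lipschitz gradient.) Standing assumption: either $\xi$ is differentiable with $\rho$-Lipschitz continuous gradient for some $\rho>0$, or $\xi$ is $L$-Lipschitz continuous for some $L>0$. Block-diagonal matrices. The instances $\{1,\dots,l\}$ are partitioned into $K$ consecutive blocks $J_1,\dots,J_K$ (one per machine), inducing a partition of the $N$ columns of $X$; $\pi(i)=k$ if column $i$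 belongs to an instance in $J_k$. Let $H_{\alpha}=X^T\nabla^2g^*(X\alpha)X$, where $\nabla^2g^*$ is the (generalized) Hessian of $g^*$, and let $(\tilde H_\alpha)_{i,j}=(H_\alpha)_{i,j}$ if $\pi(i)=\pi(j)$ and $0$ otherwise. For a symmetric positive semidefinite $B$, $\|x\|_B:=\sqrt{x^TBx}$. Method. Start from $\alpha^0\in\Omega$. At iteration $t$, given $\alpha^t\in\Omega$, choose $a_1^t,a_2^t\ge0$, not both zero, set $B_t=a_1^t\tilde H_{\alpha^t}+a_2^tI$, and let $$Q^{\alpha^t}_{B_t}(d):=\nabla G^*(\alpha^t)^Td+\tfrac12 d^TB_td+\xi^*(-\alpha^t-d).$$ A direction $\Delta\alpha^t$ is obtained by approximately minimizing $Q^{\alpha^t}_{B_t}$ (the sub-problem), and $\alpha^{t+1}=\alpha^t+\eta_t\Delta\alpha^t$. We say $\Delta\alpha^t$ solves the sub-problem $\gamma$-approximately if $$Q^{\alpha^t}_{B_t}(\Delta\alpha^t)-\min_dQ^{\alpha^t}_{B_t}(d)\le\gamma\left(Q^{\alpha^t}_{B_t}(0)-\min_dQ^{\alpha^t}_{B_t}(d)\right).$$ The step size $\eta_t$ is chosen by one of two variants: Variant I (backtracking): $\eta_t=\beta^i$ for the smallest integer $i\ge0$ such that $\eta=\beta^i$ satisfies $f(\alpha^t+\eta\Delta\alpha^t)\le f(\alpha^t)+\eta\tau\Delta_t$, where $\Delta_t:=\nabla G^*(\alpha^t)^T\Delta\alpha^t+\xi^*(-\alpha^t-\Delta\alpha^t)-\xi^*(-\alpha^t)$.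 Variant II (exact line search): $\eta_t\in\arg\min_{\eta} f(\alpha^t+\eta\Delta\alpha^t)$.
   Formalization: In (a), "close enough" is taken to mean within a radius at least the norm of the direction at step t; for exact line search (Variant II) the middle term uses the backtracking step along that direction instead of η_t. As written, the rate fails without these changes. *)

theory Defs
  imports "HOL-Analysis.Analysis"
begin

text \<open>The conjugate is relative to a linear subspace \<open>V\<close>, because \<open>\<real>\<^sup>c\<close> for a single
  block of coordinates is represented below as a coordinate subspace of \<open>\<real>\<^sup>N\<close>.\<close>

definition conjugate_on :: "'a::real_inner set \<Rightarrow> ('a \<Rightarrow> ereal) \<Rightarrow> 'a \<Rightarrow> ereal" where
  "conjugate_on V h u = (SUP z\<in>{z \<in> V. h z < \<infinity>}. ereal (z \<bullet> u) - h z)"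

abbreviation conjugate :: "('a::real_inner \<Rightarrow> ereal) \<Rightarrow> 'a \<Rightarrow> ereal" where
  "conjugate \<equiv> conjugate_on UNIV"

definition ext_epigraph :: "('a \<Rightarrow> ereal) \<Rightarrow> ('a \<times> real) set" where
  "ext_epigraph h = {(x, r). h x \<le> ereal r}"

definition proper_closed_convex :: "('a::real_normed_vector \<Rightarrow> ereal) \<Rightarrow> bool" where
  "proper_closed_convex h \<longleftrightarrow>
     (\<forall>x. h x \<noteq> -\<infinity>) \<and> (\<exists>x. h x \<noteq> \<infinity>) \<and> closed (ext_epigraph h) \<and> convex (ext_epigraph h)"

definition strongly_convex :: "real \<Rightarrow> ('a::real_normed_vector \<Rightarrow> ereal) \<Rightarrow> bool" where
  "strongly_convex \<sigma> h \<longleftrightarrow>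
     (\<forall>x y. \<forall>\<theta>\<in>{0..1}. h x < \<infinity> \<longrightarrow> h y < \<infinity> \<longrightarrow>
        h (\<theta> *\<^sub>R x + (1 - \<theta>) *\<^sub>R y)
          \<le> ereal \<theta> * h x + ereal (1 - \<theta>) * h y - ereal (\<sigma> / 2 * \<theta> * (1 - \<theta>) * (norm (x - y))\<^sup>2))"

definition grad :: "('a::real_inner \<Rightarrow> real) \<Rightarrow> 'a \<Rightarrow> 'a" where
  "grad f x = (THE D. GDERIV f x :> D)"

text \<open>For a differentiable \<open>f\<close> with Lipschitz gradient, this is Clarke's generalized Jacobian of
  \<open>grad f\<close>: the convex hull of all limits of Hessians taken at points of twice
  differentiability that converge to \<open>x\<close>. It is \<open>{\<nabla>\<^sup>2f(x)}\<close> if \<open>f\<close> is \<open>C\<^sup>2\<close> near \<open>x\<close>.\<close>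

definition gen_hessian :: "(real^'n \<Rightarrow> real) \<Rightarrow> real^'n \<Rightarrow> (real^'n^'n) set" where
  "gen_hessian f x = convex hull
     {M. \<exists>u H. u \<longlonglongrightarrow> x \<and> (\<forall>k::nat. (grad f has_derivative (\<lambda>v. H k *v v)) (at (u k))) \<and> H \<longlonglongrightarrow> M}"

text \<open>The \<open>N\<close> columns of \<open>X\<close> are indexed by \<open>'m\<close>, and \<open>inst j\<close> is the instance to which column
  \<open>j\<close> belongs, so that \<open>c\<^sub>i\<close> is the number of \<open>j\<close> with \<open>inst j = i\<close>. The space of the \<open>i\<close>-th
  component is represented by \<open>block_space inst i\<close>, and the component \<open>z\<^sub>i\<close> of \<open>z\<close> by
  \<open>block_part inst i z\<close> (the other coordinates are zero). In particular \<open>X\<^sub>i\<^sup>Tw\<close> is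
  \<open>block_part inst i (transpose X *v w)\<close>.\<close>

definition block_space :: "('m::finite \<Rightarrow> nat) \<Rightarrow> nat \<Rightarrow> (real^'m) set" where
  "block_space inst i = {z. \<forall>j. inst j \<noteq> i \<longrightarrow> z $ j = 0}"

definition block_part :: "('m::finite \<Rightarrow> nat) \<Rightarrow> nat \<Rightarrow> real^'m \<Rightarrow> real^'m" where
  "block_part inst i z = (\<chi> j. if inst j = i then z $ j else 0)"

definition total_loss ::
  "nat \<Rightarrow> ('m::finite \<Rightarrow> nat) \<Rightarrow> (nat \<Rightarrow> real^'m \<Rightarrow> real) \<Rightarrow> real^'m \<Rightarrow> real" where
  "total_loss l inst \<xi>s z = (\<Sum>i=1..l. \<xi>s i (block_part inst i z))"

definition primal_obj ::
  "nat \<Rightarrow> ('m::finite \<Rightarrow> nat) \<Rightarrow> (nat \<Rightarrow> real^'m \<Rightarrow> real) \<Rightarrow> (real^'n \<Rightarrow> ereal) \<Rightarrow> real^'m^'n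
    \<Rightarrow> real^'n \<Rightarrow> ereal" where
  "primal_obj l inst \<xi>s g X w =
     g w + ereal (\<Sum>i=1..l. \<xi>s i (block_part inst i (transpose X *v w)))"

definition dual_domain ::
  "nat \<Rightarrow> ('m::finite \<Rightarrow> nat) \<Rightarrow> (nat \<Rightarrow> real^'m \<Rightarrow> real) \<Rightarrow> (real^'m) set" where
  "dual_domain l inst \<xi>s =
     {\<alpha>. \<forall>i\<in>{1..l}. conjugate_on (block_space inst i) (\<lambda>z. ereal (\<xi>s i z)) (block_part inst i (- \<alpha>)) < \<infinity>}"

text \<open>The conjugate of a proper closed strongly convex function is finite, so \<open>real_of_ereal\<close>
  loses nothing in the following two definitions.\<close>

definition g_star :: "(real^'n \<Rightarrow> ereal) \<Rightarrow> real^'n \<Rightarrow> real" where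
  "g_star g u = real_of_ereal (conjugate g u)"

definition G_star :: "(real^'n \<Rightarrow> ereal) \<Rightarrow> real^'m^'n \<Rightarrow> real^'m::finite \<Rightarrow> real" where
  "G_star g X \<alpha> = g_star g (X *v \<alpha>)"

definition dual_obj ::
  "(real^'n \<Rightarrow> ereal) \<Rightarrow> real^'m^'n \<Rightarrow> (real^'m::finite \<Rightarrow> real) \<Rightarrow> real^'m \<Rightarrow> ereal" where
  "dual_obj g X \<xi> \<alpha> = conjugate g (X *v \<alpha>) + conjugate (\<lambda>z. ereal (\<xi> z)) (- \<alpha>)"

definition block_diag :: "('m::finite \<Rightarrow> nat) \<Rightarrow> real^'m^'m \<Rightarrow> real^'m^'m" where
  "block_diag \<pi> H = (\<chi> i j. if \<pi> i = \<pi> j then H $ i $ j else 0)"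

definition bnorm :: "real^'m^'m \<Rightarrow> real^'m::finite \<Rightarrow> real" where
  "bnorm B x = sqrt (x \<bullet> (B *v x))"

definition subproblem_obj ::
  "(real^'n \<Rightarrow> ereal) \<Rightarrow> real^'m^'n \<Rightarrow> (real^'m::finite \<Rightarrow> real) \<Rightarrow> real^'m \<Rightarrow> real^'m^'m
    \<Rightarrow> real^'m \<Rightarrow> ereal" where
  "subproblem_obj g X \<xi> \<alpha> B d =
     ereal (grad (G_star g X) \<alpha> \<bullet> d + (d \<bullet> (B *v d)) / 2) + conjugate (\<lambda>z. ereal (\<xi> z)) (- \<alpha> - d)"

definition approx_minimizer :: "real \<Rightarrow> ('a::zero \<Rightarrow> ereal) \<Rightarrow> 'a \<Rightarrow> bool" where
  "approx_minimizer \<gamma> Q d \<longleftrightarrow> Q d - (INF d'. Q d') \<le> ereal \<gamma> * (Q 0 - (INF d'. Q d'))"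

definition predicted_change ::
  "(real^'n \<Rightarrow> ereal) \<Rightarrow> real^'m^'n \<Rightarrow> (real^'m::finite \<Rightarrow> real) \<Rightarrow> real^'m \<Rightarrow> real^'m \<Rightarrow> ereal" where
  "predicted_change g X \<xi> \<alpha> d =
     ereal (grad (G_star g X) \<alpha> \<bullet> d)
       + conjugate (\<lambda>z. ereal (\<xi> z)) (- \<alpha> - d) - conjugate (\<lambda>z. ereal (\<xi> z)) (- \<alpha>)"

definition sufficient_decrease ::
  "(real^'n \<Rightarrow> ereal) \<Rightarrow> real^'m^'n \<Rightarrow> (real^'m::finite \<Rightarrow> real) \<Rightarrow> real \<Rightarrow> real^'m \<Rightarrow> real^'m
    \<Rightarrow> real \<Rightarrow> bool" where
  "sufficient_decrease g X \<xi> \<tau> \<alpha> d \<eta> \<longleftrightarrow>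
     dual_obj g X \<xi> (\<alpha> + \<eta> *\<^sub>R d) \<le> dual_obj g X \<xi> \<alpha> + ereal (\<eta> * \<tau>) * predicted_change g X \<xi> \<alpha> d"

definition backtracking_step ::
  "(real^'n \<Rightarrow> ereal) \<Rightarrow> real^'m^'n \<Rightarrow> (real^'m::finite \<Rightarrow> real) \<Rightarrow> real \<Rightarrow> real \<Rightarrow> real^'m \<Rightarrow> real^'m
    \<Rightarrow> real \<Rightarrow> bool" where
  "backtracking_step g X \<xi> \<beta> \<tau> \<alpha> d \<eta> \<longleftrightarrow>
     (\<exists>i::nat. \<eta> = \<beta> ^ i \<and> sufficient_decrease g X \<xi> \<tau> \<alpha> d (\<beta> ^ i)
        \<and> (\<forall>j<i. \<not> sufficient_decrease g X \<xi> \<tau> \<alpha> d (\<beta> ^ j)))"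

definition exact_step ::
  "(real^'n \<Rightarrow> ereal) \<Rightarrow> real^'m^'n \<Rightarrow> (real^'m::finite \<Rightarrow> real) \<Rightarrow> real^'m \<Rightarrow> real^'m
    \<Rightarrow> real \<Rightarrow> bool" where
  "exact_step g X \<xi> \<alpha> d \<eta> \<longleftrightarrow>
     (\<forall>s. dual_obj g X \<xi> (\<alpha> + \<eta> *\<^sub>R d) \<le> dual_obj g X \<xi> (\<alpha> + s *\<^sub>R d))"

definition q_linear :: "(nat \<Rightarrow> ereal) \<Rightarrow> ereal \<Rightarrow> bool" where
  "q_linear x L \<longleftrightarrow>
     \<bar>L\<bar> \<noteq> \<infinity> \<and> (\<forall>t. \<bar>x t\<bar> \<noteq> \<infinity>) \<and> x \<longlonglongrightarrow> L \<and>
     (\<exists>c::real. 0 \<le> c \<and> c < 1 \<and> (\<forall>t. \<bar>x (Suc t) - L\<bar> \<le> ereal c * \<bar>x t - L\<bar>))"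

end

theory Submission
  imports Defs
begin

text \<open>Since \<open>\<xi>\<close> is finite everywhere, \<open>\<xi>\<^sup>*\<close> grows superlinearly, so the sub-problem has a finite
  infimum \<open>m\<close> even if \<open>B\<^sub>t\<close> is singular. Comparing \<open>m\<close> with the model value at the fraction
  \<open>\<mu>\<^sub>B / 2\<close> of the way to the nearest solution gives, by (b) and convexity of \<open>G\<^sup>*\<close>, a model decrease
  of at least \<open>\<mu>\<^sub>B / 4\<close> times the dual gap, of which the inexact direction attains the share
  \<open>1 - \<gamma>\<close>. Comparing \<open>m\<close> with the model value at \<open>\<Delta>\<alpha> / (1 + \<surd>\<gamma>)\<close> gives
  \<open>\<Delta>\<^sub>t \<le> - \<parallel>\<Delta>\<alpha>\<parallel>\<^sup>2 / (1 + \<surd>\<gamma>)\<close> in the \<open>B\<^sub>t\<close>-norm, so by (a) every step up to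
  \<open>2 (1 - \<tau>) / (L\<^sub>B (1 + \<surd>\<gamma>))\<close> passes the backtracking test. The exact step is at least as good
  as the backtracking step.\<close>

section \<open>Conjugates and gradients through real inequalities\<close>

text \<open>Trades the extended-real supremum for real inequalities over the effective domain, the
  form in which conjugates are bounded below.\<close>

lemma conjugate_on_le_iff:
  assumes "\<And>z. h z \<noteq> -\<infinity>"
  shows "conjugate_on V h u \<le> ereal c \<longleftrightarrow>
    (\<forall>z\<in>V. h z < \<infinity> \<longrightarrow> z \<bullet> u - real_of_ereal (h z) \<le> c)"
proof -
  have "ereal (z \<bullet> u) - h z \<le> ereal c \<longleftrightarrow> z \<bullet> u - real_of_ereal (h z) \<le> c" if "h z < \<infinity>" for z
    using that assms[of z] by (cases "h z") auto
  then show ?thesis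
    unfolding conjugate_on_def SUP_le_iff by auto
qed

text \<open>One point of \<open>V\<close> where \<open>h\<close> is finite keeps the supremum above
  -\<infinity>: otherwise it would lie below the value at that point minus 1.\<close>

lemma conjugate_on_finite:
  assumes "\<And>z. h z \<noteq> -\<infinity>" and "z \<in> V" "h z < \<infinity>" and "conjugate_on V h u < \<infinity>"
  shows "ereal (real_of_ereal (conjugate_on V h u)) = conjugate_on V h u"
proof -
  have "conjugate_on V h u \<noteq> -\<infinity>"
    using conjugate_on_le_iff[where h = h, OF assms(1), of V u "z \<bullet> u - real_of_ereal (h z) - 1"] assms(2,3) by auto
  then show ?thesis using assms(4) by (cases "conjugate_on V h u") auto
qed

text \<open>As \<open>grad\<close> is a definite description, both existence and uniqueness of the
  derivative are required; the quadratic remainder bound gives existence.\<close>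

lemma grad_eqI:
  fixes f :: "'a::real_inner \<Rightarrow> real"
  assumes "\<And>v. \<bar>f v - f u - D \<bullet> (v - u)\<bar> \<le> C * (norm (v - u))\<^sup>2"
  shows "grad f u = D"
proof -
  have "GDERIV f u :> D"
    unfolding gderiv_def has_derivative_iff_norm
  proof (intro conjI)
    show "bounded_linear (\<lambda>h. h \<bullet> D)" by (rule bounded_linear_inner_left)
    show "((\<lambda>y. norm (f y - f u - (y - u) \<bullet> D) / norm (y - u)) \<longlongrightarrow> 0) (at u)"
    proof (rule Lim_null_comparison)
      show "\<forall>\<^sub>F y in at u. norm (norm (f y - f u - (y - u) \<bullet> D) / norm (y - u)) \<le> C * norm (y - u)"
        unfolding eventually_at_filter
        using assms by (auto simp: inner_commute divide_simps power2_eq_square mult.assoc)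
      have "((\<lambda>y. C * norm (y - u)) \<longlongrightarrow> C * norm (u - u)) (at u)" by (intro tendsto_intros)
      then show "((\<lambda>y. C * norm (y - u)) \<longlongrightarrow> 0) (at u)" by simp
    qed
  qed
  moreover have "D' = D" if "GDERIV f u :> D'" for D'
  proof -
    have "(\<lambda>h. h \<bullet> D') = (\<lambda>h. h \<bullet> D)"
      using that \<open>GDERIV f u :> D\<close> unfolding gderiv_def by (rule has_derivative_unique)
    then show ?thesis by (metis inner_commute vector_eq_rdot)
  qed
  ultimately show ?thesis unfolding grad_def by (rule the_equality)
qed

section \<open>Finiteness and smoothness of the conjugate of a strongly convex function\<close>

lemma strongly_convexD:
  assumes "strongly_convex \<sigma> g" and "\<And>w. g w \<noteq> -\<infinity>"
    and "g x < \<infinity>" "g y < \<infinity>" "0 \<le> \<theta>" "\<theta> \<le> 1"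
  shows "g (\<theta> *\<^sub>R x + (1 - \<theta>) *\<^sub>R y) < \<infinity>"
    and "real_of_ereal (g (\<theta> *\<^sub>R x + (1 - \<theta>) *\<^sub>R y)) \<le> \<theta> * real_of_ereal (g x)
      + (1 - \<theta>) * real_of_ereal (g y) - \<sigma> / 2 * \<theta> * (1 - \<theta>) * (norm (x - y))\<^sup>2"
proof -
  obtain a where a: "g x = ereal a" using assms(2)[of x] assms(3) by (cases "g x") auto
  obtain b where b: "g y = ereal b" using assms(2)[of y] assms(4) by (cases "g y") auto
  have *: "g (\<theta> *\<^sub>R x + (1 - \<theta>) *\<^sub>R y)
      \<le> ereal (\<theta> * a + (1 - \<theta>) * b - \<sigma> / 2 * \<theta> * (1 - \<theta>) * (norm (x - y))\<^sup>2)"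
    using assms(1)[unfolded strongly_convex_def, rule_format, of \<theta> x y] assms a b by auto
  then show "g (\<theta> *\<^sub>R x + (1 - \<theta>) *\<^sub>R y) < \<infinity>"
    by (rule order_le_less_trans) simp
  show "real_of_ereal (g (\<theta> *\<^sub>R x + (1 - \<theta>) *\<^sub>R y)) \<le> \<theta> * real_of_ereal (g x)
      + (1 - \<theta>) * real_of_ereal (g y) - \<sigma> / 2 * \<theta> * (1 - \<theta>) * (norm (x - y))\<^sup>2"
    using * a b assms(2)[of "\<theta> *\<^sub>R x + (1 - \<theta>) *\<^sub>R y"]
    by (cases "g (\<theta> *\<^sub>R x + (1 - \<theta>) *\<^sub>R y)") auto
qed

lemma linear_minus_quadratic_le:
  fixes a b R :: real
  assumes "a > 0"
  shows "b * R - a * R\<^sup>2 \<le> b\<^sup>2 / (4 * a)"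
proof -
  have "0 \<le> (2 * a * R - b)\<^sup>2" by simp
  then show ?thesis using assms by (simp add: field_simps power2_eq_square)
qed

text \<open>Inside the unit ball \<open>m\<close> bounds \<open>g\<close> from below. Outside,
  strong convexity on the segment from \<open>w0\<close> to \<open>w\<close>, tested at distance 1
  from \<open>w0\<close>, makes \<open>g\<close> grow quadratically, which beats the linear
  term.\<close>

lemma strongly_convex_conjugate_finite:
  fixes g :: "'a::real_inner \<Rightarrow> ereal"
  assumes sc: "strongly_convex \<sigma> g" "\<sigma> > 0" and g: "\<And>w. g w \<noteq> -\<infinity>" and w0: "g w0 < \<infinity>"
    and m: "\<And>w. w \<in> cball w0 1 \<Longrightarrow> ereal m \<le> g w"
  shows "conjugate g u < \<infinity>"
proof -
  define k where "k w = real_of_ereal (g w)" for w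
  have mk: "m \<le> k w" if "dist w0 w \<le> 1" "g w < \<infinity>" for w
    using m[of w] that g[of w] unfolding k_def by (cases "g w") auto
  \<comment> \<open>\<open>b\<close> is the coefficient of \<open>R\<close> after the quadratic
    lower bound on \<open>g\<close> is inserted outside the ball; \<open>c\<close> is the larger of
    the inner and outer bounds.\<close>
  define b where "b = norm u - m + k w0 + \<sigma> / 2"
  define c where "c = max (norm w0 * norm u + norm u - m) (w0 \<bullet> u - k w0 + b\<^sup>2 / (2 * \<sigma>))"
  have "w \<bullet> u - k w \<le> c" if w: "g w < \<infinity>" for w
  proof (cases "dist w0 w \<le> 1")
    case True
    have "norm w \<le> norm w0 + 1"
      using True norm_triangle_ineq[of w0 "w - w0"] by (simp add: dist_norm norm_minus_commute)
    then have "w \<bullet> u \<le> (norm w0 + 1) * norm u"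
      by (meson norm_cauchy_schwarz norm_ge_zero mult_right_mono order_trans)
    then show ?thesis using mk[OF True w] unfolding c_def by (simp add: algebra_simps)
  next
    case False
    define R where "R = norm (w - w0)"
    have R: "R > 1" using False by (simp add: R_def dist_norm norm_minus_commute)
    define w' where "w' = (1/R) *\<^sub>R w + (1 - 1/R) *\<^sub>R w0"
    have s: "g w' < \<infinity>" "k w' \<le> (1/R) * k w + (1 - 1/R) * k w0 - \<sigma>/2 * (1/R) * (1 - 1/R) * R\<^sup>2"
      using strongly_convexD[OF sc(1) g w w0, of "1/R"] R unfolding w'_def k_def R_def[symmetric] by auto
    have "w' - w0 = (1/R) *\<^sub>R (w - w0)" unfolding w'_def by (simp add: algebra_simps)
    then have "norm (w' - w0) = 1" using R by (simp flip: R_def)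
    then have "m \<le> k w'" using mk[OF _ s(1)] by (simp add: dist_norm norm_minus_commute)
    then have "R * m \<le> R * ((1/R) * k w + (1 - 1/R) * k w0 - \<sigma>/2 * (1/R) * (1 - 1/R) * R\<^sup>2)"
      using s(2) R by simp
    also have "\<dots> = k w + (R - 1) * k w0 - \<sigma>/2 * R * (R - 1)"
      using R by (simp add: field_simps power2_eq_square)
    finally have 1: "R * m \<le> k w + (R - 1) * k w0 - \<sigma>/2 * R * (R - 1)" .
    have "w \<bullet> u = w0 \<bullet> u + (w - w0) \<bullet> u" by (simp add: algebra_simps)
    also have "\<dots> \<le> w0 \<bullet> u + R * norm u" unfolding R_def using norm_cauchy_schwarz by auto
    finally have "w \<bullet> u - k w \<le> w0 \<bullet> u - k w0 + (b * R - \<sigma>/2 * R\<^sup>2)"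
      using 1 by (simp add: b_def algebra_simps power2_eq_square diff_divide_distrib)
    also have "\<dots> \<le> w0 \<bullet> u - k w0 + b\<^sup>2 / (2 * \<sigma>)"
      using linear_minus_quadratic_le[of "\<sigma>/2" b R] sc(2) by simp
    finally show ?thesis unfolding c_def by simp
  qed
  then have "conjugate g u \<le> ereal c"
    unfolding conjugate_on_le_iff[where h = g, OF g] k_def by auto
  then show ?thesis by (rule order_le_less_trans) simp
qed

text \<open>\<open>D\<close> is the limit of a maximizing sequence for the supremum
  \<open>gs u\<close>, Cauchy by strong convexity. As \<open>D\<close> is not shown to lie in the
  domain of \<open>g\<close>, only inequalities for the gap \<open>a\<close> pass to the limit.
  Quadratic growth of \<open>a\<close> around \<open>D\<close> dualizes to the upper bound on
  \<open>gs\<close>.\<close>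

lemma strongly_convex_conjugate_quadratic_bounds:
  fixes g :: "'a::{real_inner, complete_space} \<Rightarrow> ereal" and gs :: "'a \<Rightarrow> real"
  assumes sc: "strongly_convex \<sigma> g" "\<sigma> > 0" and g: "\<And>w. g w \<noteq> -\<infinity>"
    and gs: "\<And>v. conjugate g v = ereal (gs v)"
  shows "\<exists>D. \<forall>v. gs u + D \<bullet> (v - u) \<le> gs v \<and> gs v \<le> gs u + D \<bullet> (v - u) + (norm (v - u))\<^sup>2 / (2 * \<sigma>)"
proof -
  define k where "k w = real_of_ereal (g w)" for w
  define a where "a w = gs u - (w \<bullet> u - k w)" for w
  have le: "gs v \<le> c \<longleftrightarrow> (\<forall>w. g w < \<infinity> \<longrightarrow> w \<bullet> v - k w \<le> c)" for v c
    using conjugate_on_le_iff[where h = g, OF g, of UNIV v c] gs[of v] unfolding k_def by auto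
  have a0: "0 \<le> a w" if "g w < \<infinity>" for w
    using le[of u "gs u"] that by (auto simp: a_def)
  \<comment> \<open>The gap at the convex combination is nonnegative, so the two gaps pay for the
    strong convexity surplus.\<close>
  have key: "\<sigma>/2 * \<theta> * (1 - \<theta>) * (norm (x - y))\<^sup>2 \<le> \<theta> * a x + (1 - \<theta>) * a y"
    if "g x < \<infinity>" "g y < \<infinity>" "0 \<le> \<theta>" "\<theta> \<le> 1" for x y \<theta>
    using a0[OF strongly_convexD(1)[OF sc(1) g that]] strongly_convexD(2)[OF sc(1) g that]
    unfolding a_def k_def[symmetric] by (simp add: algebra_simps)
  have "\<exists>w. g w < \<infinity> \<and> a w < 1 / real (Suc j)" for j
  proof (rule ccontr)
    assume "\<not> ?thesis"
    then have "gs u \<le> gs u - 1 / real (Suc j)"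
      unfolding le a_def by (auto simp: not_less)
    then show False by (simp add: field_simps)
  qed
  then obtain w where w: "\<And>j. g (w j) < \<infinity>" "\<And>j. a (w j) < 1 / real (Suc j)" by metis
  have a_lim: "(\<lambda>j. a (w j)) \<longlonglongrightarrow> 0"
    by (rule tendsto_sandwich[OF _ _ tendsto_const LIMSEQ_inverse_real_of_nat])
      (use w a0 in \<open>auto intro!: always_eventually less_imp_le simp: inverse_eq_divide\<close>)
  have "Cauchy w"
  proof (rule metric_CauchyI)
    fix e :: real assume e: "e > 0"
    \<comment> \<open>The threshold matches \<open>key\<close> at \<theta> = 1/2, which bounds
      \<sigma>/8 times the squared distance by the mean of the two gaps.\<close>
    obtain n where n: "\<And>j. j \<ge> n \<Longrightarrow> a (w j) < \<sigma> * e\<^sup>2 / 8"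
      using order_tendstoD(2)[OF a_lim, of "\<sigma> * e\<^sup>2 / 8"] e sc(2)
      unfolding eventually_sequentially by auto
    have "dist (w i) (w j) < e" if "i \<ge> n" "j \<ge> n" for i j
    proof -
      have "\<sigma>/8 * (norm (w i - w j))\<^sup>2 < \<sigma>/8 * e\<^sup>2"
        using key[OF w(1)[of i] w(1)[of j], of "1/2"] n[OF that(1)] n[OF that(2)] by simp
      then have "(norm (w i - w j))\<^sup>2 < e\<^sup>2" using sc(2) by simp
      then show ?thesis using e by (simp add: dist_norm power2_less_imp_less)
    qed
    then show "\<exists>M. \<forall>m\<ge>M. \<forall>n\<ge>M. dist (w m) (w n) < e" by blast
  qed
  then obtain D where D: "w \<longlonglongrightarrow> D" using Cauchy_convergent_iff convergentD by blast
  have 1: "\<sigma>/2 * \<theta> * (1 - \<theta>) * (norm (x - D))\<^sup>2 \<le> \<theta> * a x + (1 - \<theta>) * 0"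
    if "g x < \<infinity>" "0 \<le> \<theta>" "\<theta> \<le> 1" for x \<theta>
  proof (rule LIMSEQ_le)
    show "(\<lambda>j. \<sigma>/2 * \<theta> * (1 - \<theta>) * (norm (x - w j))\<^sup>2) \<longlonglongrightarrow> \<sigma>/2 * \<theta> * (1 - \<theta>) * (norm (x - D))\<^sup>2"
      by (intro tendsto_intros D)
    show "(\<lambda>j. \<theta> * a x + (1 - \<theta>) * a (w j)) \<longlonglongrightarrow> \<theta> * a x + (1 - \<theta>) * 0"
      by (intro tendsto_intros a_lim)
  qed (use key[OF that(1) w(1) that(2,3)] in blast)
  \<comment> \<open>Dividing by \<theta> and letting \<theta> tend to 0 from the right recovers the
    full constant \<sigma>/2.\<close>
  have quad: "\<sigma>/2 * (norm (x - D))\<^sup>2 \<le> a x" if x: "g x < \<infinity>" for x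
  proof (rule tendsto_upperbound)
    show "((\<lambda>\<theta>. \<sigma>/2 * (1 - \<theta>) * (norm (x - D))\<^sup>2) \<longlongrightarrow> \<sigma>/2 * (norm (x - D))\<^sup>2) (at_right 0)"
      by (auto intro!: tendsto_eq_intros)
    show "\<forall>\<^sub>F \<theta> in at_right 0. \<sigma>/2 * (1 - \<theta>) * (norm (x - D))\<^sup>2 \<le> a x"
    proof (rule eventually_at_rightI[of 0 1])
      fix \<theta> :: real assume \<theta>: "\<theta> \<in> {0<..<1}"
      have "\<theta> * (\<sigma>/2 * (1 - \<theta>) * (norm (x - D))\<^sup>2) \<le> \<theta> * a x"
        using 1[OF x, of \<theta>] \<theta> by (simp add: mult.assoc mult.left_commute)
      then show "\<sigma>/2 * (1 - \<theta>) * (norm (x - D))\<^sup>2 \<le> a x"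
        by (rule mult_left_le_imp_le) (use \<theta> in simp)
    qed auto
  qed simp
  show ?thesis
  proof (intro exI allI conjI)
    fix v
    show "gs u + D \<bullet> (v - u) \<le> gs v"
    proof (rule LIMSEQ_le_const2)
      have "(\<lambda>j. gs u + w j \<bullet> (v - u) - a (w j)) \<longlonglongrightarrow> gs u + D \<bullet> (v - u) - 0"
        by (intro tendsto_intros D a_lim)
      then show "(\<lambda>j. gs u + w j \<bullet> (v - u) - a (w j)) \<longlonglongrightarrow> gs u + D \<bullet> (v - u)" by simp
      have "w j \<bullet> v - k (w j) \<le> gs v" for j using le[of v "gs v"] w(1) by auto
      then show "\<exists>N. \<forall>n\<ge>N. gs u + w n \<bullet> (v - u) - a (w n) \<le> gs v"
        by (auto simp: a_def algebra_simps)
    qed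
    \<comment> \<open>By \<open>quad\<close>, the excess of each \<open>x\<close> over the linear
      part is at most a linear minus a quadratic function of \<open>norm (x - D)\<close>, whose
      maximum is the last term.\<close>
    show "gs v \<le> gs u + D \<bullet> (v - u) + (norm (v - u))\<^sup>2 / (2 * \<sigma>)"
      unfolding le
    proof (intro allI impI)
      fix x assume x: "g x < \<infinity>"
      have "(x - D) \<bullet> (v - u) \<le> norm (v - u) * norm (x - D)"
        by (metis norm_cauchy_schwarz mult.commute)
      moreover have "norm (v - u) * norm (x - D) - \<sigma>/2 * (norm (x - D))\<^sup>2 \<le> (norm (v - u))\<^sup>2 / (2 * \<sigma>)"
        using linear_minus_quadratic_le[of "\<sigma>/2" "norm (v - u)" "norm (x - D)"] sc(2) by simp
      ultimately have "(x - D) \<bullet> (v - u) - a x \<le> (norm (v - u))\<^sup>2 / (2 * \<sigma>)"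
        using quad[OF x] by linarith
      then show "x \<bullet> v - k x \<le> gs u + D \<bullet> (v - u) + (norm (v - u))\<^sup>2 / (2 * \<sigma>)"
        by (simp add: a_def algebra_simps)
    qed
  qed
qed

section \<open>Positive semidefiniteness of the matrices of the method\<close>

text \<open>The quadratic form is the derivative at 0 of
  \<open>v \<bullet> grad f (u + s *\<^sub>R v)\<close> in \<open>s\<close>, whose right difference
  quotients are nonnegative by monotonicity.\<close>

lemma grad_monotone_imp_derivative_nonneg:
  fixes f :: "real^'n \<Rightarrow> real"
  assumes mono: "\<And>x y. 0 \<le> (grad f y - grad f x) \<bullet> (y - x)"
    and der: "(grad f has_derivative (\<lambda>v. H *v v)) (at u)"
  shows "0 \<le> v \<bullet> (H *v v)"
proof -
  have "((\<lambda>s. u + s *\<^sub>R v) has_derivative (\<lambda>s. s *\<^sub>R v)) (at 0)"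
    by (auto intro!: derivative_eq_intros)
  moreover have "(grad f has_derivative (\<lambda>v. H *v v)) (at (u + 0 *\<^sub>R v))" using der by simp
  ultimately have "((\<lambda>s. grad f (u + s *\<^sub>R v)) has_derivative (\<lambda>s. H *v (s *\<^sub>R v))) (at 0)"
    by (rule has_derivative_compose)
  then have "((\<lambda>s. v \<bullet> grad f (u + s *\<^sub>R v)) has_derivative (\<lambda>s. v \<bullet> (H *v (s *\<^sub>R v)))) (at 0)"
    by (rule has_derivative_inner_right)
  then have "((\<lambda>s. v \<bullet> grad f (u + s *\<^sub>R v)) has_real_derivative v \<bullet> (H *v v)) (at 0)"
    by (simp add: has_field_derivative_def matrix_vector_mult_scaleR mult_commute_abs)
  then have "((\<lambda>s. (v \<bullet> grad f (u + s *\<^sub>R v) - v \<bullet> grad f u) / s) \<longlongrightarrow> v \<bullet> (H *v v)) (at 0)"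
    by (simp add: DERIV_def)
  then have "((\<lambda>s. (v \<bullet> grad f (u + s *\<^sub>R v) - v \<bullet> grad f u) / s) \<longlongrightarrow> v \<bullet> (H *v v)) (at_right 0)"
    by (rule tendsto_mono[OF at_le[OF subset_UNIV]])
  then show ?thesis
  proof (rule tendsto_lowerbound)
    show "\<forall>\<^sub>F s in at_right 0. 0 \<le> (v \<bullet> grad f (u + s *\<^sub>R v) - v \<bullet> grad f u) / s"
    proof (rule eventually_at_rightI[of 0 1])
      fix s :: real assume s: "s \<in> {0<..<1}"
      have "0 \<le> s * (v \<bullet> grad f (u + s *\<^sub>R v) - v \<bullet> grad f u)"
        using mono[where y = "u + s *\<^sub>R v" and x = u] by (simp add: inner_commute inner_diff_right right_diff_distrib)
      then show "0 \<le> (v \<bullet> grad f (u + s *\<^sub>R v) - v \<bullet> grad f u) / s"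
        using s by (simp add: zero_le_mult_iff)
    qed simp
  qed simp
qed

text \<open>For fixed \<open>v\<close> the matrices with nonnegative form form a closed convex set,
  so neither the limits nor the hull in \<open>gen_hessian\<close> leave it.\<close>

lemma gen_hessian_nonneg:
  fixes f :: "real^'n \<Rightarrow> real"
  assumes mono: "\<And>x y. 0 \<le> (grad f y - grad f x) \<bullet> (y - x)" and M: "M \<in> gen_hessian f x"
  shows "0 \<le> v \<bullet> (M *v v)"
proof -
  let ?P = "{M. 0 \<le> v \<bullet> (M *v v)}"
  have "convex ?P"
    by (auto simp: convex_def matrix_vector_mult_add_rdistrib inner_add_right
        simp flip: scaleR_matrix_vector_assoc)
  moreover have "closed ?P"
    unfolding matrix_vector_mult_def
    by (intro closed_Collect_le continuous_intros)
  then have "N \<in> ?P" if "\<And>k. (grad f has_derivative (\<lambda>v. H k *v v)) (at (u k))" "H \<longlonglongrightarrow> N" for u H N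
    using grad_monotone_imp_derivative_nonneg[OF mono that(1)]
    by (intro closed_sequentially[OF _ _ that(2)]) auto
  ultimately have "gen_hessian f x \<subseteq> ?P"
    unfolding gen_hessian_def by (intro hull_minimal) auto
  then show ?thesis using M by auto
qed

text \<open>Shows that dropping the entries between different blocks preserves
  semidefiniteness.\<close>

lemma block_diag_quadratic:
  fixes H :: "real^'m::finite^'m" and \<pi> :: "'m \<Rightarrow> nat"
  shows "v \<bullet> (block_diag \<pi> H *v v) = (\<Sum>k\<in>range \<pi>. block_part \<pi> k v \<bullet> (H *v block_part \<pi> k v))"
proof -
  have "(\<Sum>k\<in>range \<pi>. block_part \<pi> k v \<bullet> (H *v block_part \<pi> k v))
      = (\<Sum>k\<in>range \<pi>. \<Sum>i\<in>UNIV. \<Sum>j\<in>UNIV. if \<pi> i = k \<and> \<pi> j = k then v $ i * (H $ i $ j * v $ j) else 0)"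
    unfolding inner_vec_def matrix_vector_mult_def block_part_def
    by (auto simp: sum_distrib_left intro!: sum.cong)
  also have "\<dots> = (\<Sum>i\<in>UNIV. \<Sum>j\<in>UNIV. \<Sum>k\<in>range \<pi>. if \<pi> i = k \<and> \<pi> j = k then v $ i * (H $ i $ j * v $ j) else 0)"
    by (subst sum.swap, rule sum.cong[OF refl], subst sum.swap, rule refl)
  also have "\<dots> = (\<Sum>i\<in>UNIV. \<Sum>j\<in>UNIV. if \<pi> i = \<pi> j then v $ i * (H $ i $ j * v $ j) else 0)"
  proof (intro sum.cong refl)
    fix i j
    have "(\<Sum>k\<in>range \<pi>. if \<pi> i = k \<and> \<pi> j = k then v $ i * (H $ i $ j * v $ j) else 0)
      = (\<Sum>k\<in>range \<pi>. if k = \<pi> i then (if \<pi> i = \<pi> j then v $ i * (H $ i $ j * v $ j) else 0) else 0)"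
      by (intro sum.cong) auto
    then show "(\<Sum>k\<in>range \<pi>. if \<pi> i = k \<and> \<pi> j = k then v $ i * (H $ i $ j * v $ j) else 0)
      = (if \<pi> i = \<pi> j then v $ i * (H $ i $ j * v $ j) else 0)" by simp
  qed
  also have "\<dots> = v \<bullet> (block_diag \<pi> H *v v)"
    unfolding inner_vec_def matrix_vector_mult_def block_diag_def
    by (auto simp: sum_distrib_left intro!: sum.cong)
  finally show ?thesis ..
qed

lemma block_diag_gram_nonneg:
  fixes X :: "real^'m::finite^'n" and M :: "real^'n^'n" and \<pi> :: "'m \<Rightarrow> nat"
  assumes "\<And>v. 0 \<le> v \<bullet> (M *v v)" "0 \<le> a1" "0 \<le> a2"
  shows "0 \<le> v \<bullet> ((a1 *\<^sub>R block_diag \<pi> (transpose X ** M ** X) + a2 *\<^sub>R mat 1) *v v)"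
proof -
  have "v \<bullet> ((transpose X ** M ** X) *v v) = (X *v v) \<bullet> (M *v (X *v v))" for v
    by (simp add: transpose_matrix_vector dot_lmul_matrix inner_commute[of v] inner_commute[of "X *v v"]
        flip: matrix_vector_mul_assoc)
  then have "0 \<le> v \<bullet> (block_diag \<pi> (transpose X ** M ** X) *v v)"
    unfolding block_diag_quadratic using assms(1) by (simp add: sum_nonneg)
  then show ?thesis using assms(2,3)
    by (simp add: matrix_vector_mult_add_rdistrib inner_add_right flip: scaleR_matrix_vector_assoc)
qed

section \<open>Splitting by instances, and scalar estimates for curvature, step size and
  rate\<close>

lemma inner_block_part:
  fixes inst :: "'m::finite \<Rightarrow> nat"
  assumes "range inst = {1..l}"
  shows "x \<bullet> y = (\<Sum>i=1..l. block_part inst i x \<bullet> block_part inst i y)"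
proof -
  have "(\<Sum>i=1..l. block_part inst i x \<bullet> block_part inst i y)
      = (\<Sum>j\<in>UNIV. \<Sum>i=1..l. if inst j = i then x $ j * y $ j else 0)"
    unfolding inner_vec_def block_part_def by (subst sum.swap) (auto intro!: sum.cong)
  also have "\<dots> = x \<bullet> y"
    using assms by (auto simp: inner_vec_def intro!: sum.cong)
  finally show ?thesis ..
qed

text \<open>Here \<open>m\<close> stands for the infimum of the model minus its value at \<open>0\<close>, and \<open>low\<close> comes from
  the segment towards the direction. Eliminating \<open>m\<close> at \<open>\<theta> = 1 / (1 + \<surd>\<gamma>)\<close> avoids any reference
  to a minimizer; if \<open>\<gamma> = 0\<close> this is the endpoint \<open>\<theta> = 1\<close> and needs a limit.\<close>

lemma approx_minimizer_curvature:
  fixes D q m c \<gamma> :: real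
  assumes \<gamma>: "0 \<le> \<gamma>" "\<gamma> < 1" and q: "0 \<le> q"
    and low: "\<And>\<theta>. 0 \<le> \<theta> \<Longrightarrow> \<theta> \<le> 1 \<Longrightarrow> m \<le> \<theta> * D + \<theta>\<^sup>2 * q / 2"
    and appr: "D + q / 2 \<le> (1 - \<gamma>) * m"
  shows "q / (1 + sqrt \<gamma>) \<le> - D"
proof -
  define s where "s = sqrt \<gamma>"
  have s: "0 \<le> s" "s < 1" "\<gamma> = s\<^sup>2" using \<gamma> by (auto simp: s_def)
  have bound: "D + q / 2 \<le> (1 - s\<^sup>2) * (\<theta> * D + \<theta>\<^sup>2 * q / 2)" if "0 \<le> \<theta>" "\<theta> \<le> 1" for \<theta>
    using order_trans[OF appr mult_left_mono[OF low[OF that]]] \<gamma> s(3) by simp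
  show ?thesis
  proof (cases "s = 0")
    case True
    \<comment> \<open>Here \<open>bound\<close> is trivial at \<theta> = 1; below 1 the factor 1 -
      \<theta> is divided out before the limit.\<close>
    have "q \<le> - D"
    proof (rule tendsto_upperbound)
      show "((\<lambda>\<theta>. q * (1 + \<theta>) / 2) \<longlongrightarrow> q) (at_left 1)" by (auto intro!: tendsto_eq_intros)
      show "\<forall>\<^sub>F \<theta> in at_left 1. q * (1 + \<theta>) / 2 \<le> - D"
      proof (rule eventually_at_leftI[of 0])
        fix \<theta> :: real assume \<theta>: "\<theta> \<in> {0<..<1}"
        have "(1 - \<theta>) * (q * (1 + \<theta>) / 2) \<le> (1 - \<theta>) * (- D)"
          using bound[of \<theta>] \<theta> True
          by (simp add: algebra_simps power2_eq_square add_divide_distrib diff_divide_distrib)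
        then show "q * (1 + \<theta>) / 2 \<le> - D" by (rule mult_left_le_imp_le) (use \<theta> in simp)
      qed simp
    qed simp
    then show ?thesis using True s_def by simp
  next
    case False
    define r where "r = 1 + s"
    have r: "r > 0" "s = r - 1" using s by (auto simp: r_def)
    have "D + q / 2 \<le> (1 - s\<^sup>2) * (1 / r * D + (1 / r)\<^sup>2 * q / 2)"
      using bound[of "1 / r"] s by (auto simp: r_def)
    also have "\<dots> = (1 - s) * D + (1 - s) / r * q / 2"
    proof -
      have *: "1 - s\<^sup>2 = (1 - s) * r" by (simp add: r_def algebra_simps power2_eq_square)
      show ?thesis unfolding * using r(1) by (simp add: field_simps power2_eq_square)
    qed
    finally have "s * D + (q / 2 - (1 - s) / r * q / 2) \<le> 0"
      using left_diff_distrib[of 1 s D] by linarith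
    then have "s * D + (1 - (1 - s) / r) * q / 2 \<le> 0"
      by (simp only: left_diff_distrib diff_divide_distrib mult_1)
    \<comment> \<open>Both terms then carry the factor \<open>s\<close>, which is nonzero in this
      case and cancels.\<close>
    moreover have E: "1 - (1 - s) / r = s * (2 / r)" using r by (simp add: field_simps)
    ultimately have "s * D + s * (2 / r) * q / 2 \<le> 0" by (simp only: E)
    then have "s * (D + q / r) \<le> 0" by (simp add: distrib_left)
    then have "D + q / r \<le> 0" using False s(1) by (simp add: mult_le_0_iff)
    then show ?thesis by (simp add: r_def s_def)
  qed
qed

text \<open>Termination of backtracking: powers of \<beta> fall below any positive
  threshold.\<close>

lemma backtracking_exponent:
  fixes \<beta> c :: real
  assumes \<beta>: "0 < \<beta>" "\<beta> < 1" and c: "0 < c"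
    and P: "\<And>x. 0 < x \<Longrightarrow> x \<le> 1 \<Longrightarrow> x \<le> c \<Longrightarrow> P x"
  shows "\<exists>i. P (\<beta> ^ i) \<and> (\<forall>j<i. \<not> P (\<beta> ^ j))"
proof -
  obtain i where "\<beta> ^ i < c" using real_arch_pow_inv[OF c \<beta>(2)] by auto
  then have "P (\<beta> ^ i)" using P[of "\<beta> ^ i"] \<beta> by (simp add: power_le_one)
  then have "\<exists>i. P (\<beta> ^ i)" ..
  then show ?thesis by (rule exists_least_iff[THEN iffD1])
qed

text \<open>If \<open>i\<close> is positive, the preceding trial was rejected and hence exceeds
  \<open>c\<close>; one more factor \<beta> gives the bound.\<close>

lemma backtracking_lower_bound:
  fixes \<beta> c :: real
  assumes \<beta>: "0 < \<beta>" "\<beta> < 1"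
    and P: "\<And>x. 0 < x \<Longrightarrow> x \<le> 1 \<Longrightarrow> x \<le> c \<Longrightarrow> P x"
    and i: "\<forall>j<i. \<not> P (\<beta> ^ j)"
  shows "min 1 (\<beta> * c) \<le> \<beta> ^ i"
proof (cases i)
  case (Suc j)
  then have "c < \<beta> ^ j" using P[of "\<beta> ^ j"] i \<beta> by (force simp: power_le_one)
  then show ?thesis using Suc \<beta> by (simp add: min.coboundedI2)
qed simp

text \<open>The factorization 1 - \<gamma> = (1 - \<open>sqrt \<gamma>\<close>)(1 +
  \<open>sqrt \<gamma>\<close>) cancels the denominator of the step threshold and leaves the second
  entry of the minimum.\<close>

lemma rate_bound:
  fixes \<gamma> \<beta> \<tau> \<mu> L s :: real
  assumes "0 \<le> \<gamma>" "\<gamma> < 1" "0 < \<tau>" "\<tau> < 1" "0 < \<mu>" "0 < L"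
    and s: "min 1 (\<beta> * (2 * (1 - \<tau>) / (L * (1 + sqrt \<gamma>)))) \<le> s"
  shows "1 - \<tau> * \<mu> * (1 - \<gamma>) * s / 4
    \<le> 1 - \<tau> * \<mu> / 2 * min ((1 - \<gamma>) / 2) (\<beta> * (1 - \<tau>) * (1 - sqrt \<gamma>) / L)"
proof -
  define u where "u = sqrt \<gamma>"
  have u: "0 \<le> u" "u < 1" "\<gamma> = u\<^sup>2" using assms by (auto simp: u_def)
  have "(1 - \<gamma>) / 2 * (\<beta> * (2 * (1 - \<tau>) / (L * (1 + u)))) = \<beta> * (1 - \<tau>) * (1 - u) / L"
  proof -
    have "(1 - \<gamma>) = (1 - u) * (1 + u)" using u by (simp add: algebra_simps power2_eq_square)
    then show ?thesis using u(1) by (simp add: divide_simps)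
  qed
  then have "min ((1 - \<gamma>) / 2) (\<beta> * (1 - \<tau>) * (1 - u) / L)
      = (1 - \<gamma>) / 2 * min 1 (\<beta> * (2 * (1 - \<tau>) / (L * (1 + u))))"
    using assms(2) by (simp add: min_mult_distrib_left)
  also have "\<dots> \<le> (1 - \<gamma>) / 2 * s"
    using s assms(2) by (intro mult_left_mono) (auto simp: u_def)
  finally have "\<tau> * \<mu> / 2 * min ((1 - \<gamma>) / 2) (\<beta> * (1 - \<tau>) * (1 - u) / L) \<le> \<tau> * \<mu> / 2 * ((1 - \<gamma>) / 2 * s)"
    using assms by (intro mult_left_mono) auto
  then show ?thesis by (simp add: u_def algebra_simps)
qed

lemma q_linear_ereal:
  fixes F :: "nat \<Rightarrow> real"
  assumes c: "0 \<le> c" "c < 1" and ge: "\<And>t. L \<le> F t"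
    and step: "\<And>t. F (Suc t) - L \<le> c * (F t - L)"
  shows "q_linear (\<lambda>t. ereal (F t)) (ereal L)"
proof -
  have bound: "F t - L \<le> c ^ t * (F 0 - L)" for t
  proof (induction t)
    case (Suc t)
    then show ?case using step[of t] mult_left_mono[OF Suc c(1)] by simp
  qed simp
  have lim: "(\<lambda>t. c ^ t * (F 0 - L)) \<longlonglongrightarrow> 0"
    using c by (intro tendsto_mult_left_zero LIMSEQ_power_zero) auto
  have "(\<lambda>t. F t - L) \<longlonglongrightarrow> 0"
    by (rule tendsto_sandwich[OF always_eventually always_eventually tendsto_const lim])
      (simp_all add: ge bound)
  then have "F \<longlonglongrightarrow> L" by (simp add: LIM_zero_iff)
  moreover have "\<bar>F (Suc t) - L\<bar> \<le> c * \<bar>F t - L\<bar>" for t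
    using step[of t] ge[of t] ge[of "Suc t"] by simp
  ultimately show ?thesis unfolding q_linear_def using c by (auto intro!: exI[of _ c])
qed

section \<open>The dual domain and the real-valued dual loss\<close>

text \<open>The loss is separable: bounds for the single instances add up, and conversely a vector
  supported on one instance tests that instance alone.\<close>

lemma dual_domain_iff:
  fixes inst :: "'m::finite \<Rightarrow> nat"
  assumes inst: "range inst = {1..l}"
  shows "x \<in> dual_domain l inst \<xi>s \<longleftrightarrow> conjugate (\<lambda>z. ereal (total_loss l inst \<xi>s z)) (- x) < \<infinity>"
proof
  assume x: "x \<in> dual_domain l inst \<xi>s"
  define c where "c i = real_of_ereal
    (conjugate_on (block_space inst i) (\<lambda>z. ereal (\<xi>s i z)) (block_part inst i (- x)))" for i
  have c: "z \<bullet> block_part inst i (- x) - \<xi>s i z \<le> c i" if i: "i \<in> {1..l}" and z: "z \<in> block_space inst i" for i z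
  proof -
    have "conjugate_on (block_space inst i) (\<lambda>z. ereal (\<xi>s i z)) (block_part inst i (- x)) = ereal (c i)"
      unfolding c_def using x i z by (intro conjugate_on_finite[symmetric]) (auto simp: dual_domain_def)
    then show ?thesis
      using conjugate_on_le_iff[where h = "\<lambda>z. ereal (\<xi>s i z)" and V = "block_space inst i"
          and u = "block_part inst i (- x)" and c = "c i"] z by auto
  qed
  have "z \<bullet> - x - total_loss l inst \<xi>s z \<le> (\<Sum>i=1..l. c i)" for z
    unfolding inner_block_part[OF inst, of z] total_loss_def sum_subtractf[symmetric]
    by (intro sum_mono c) (auto simp: block_space_def block_part_def)
  then have "conjugate (\<lambda>z. ereal (total_loss l inst \<xi>s z)) (- x) \<le> ereal (\<Sum>i=1..l. c i)"
    by (subst conjugate_on_le_iff) auto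
  then show "conjugate (\<lambda>z. ereal (total_loss l inst \<xi>s z)) (- x) < \<infinity>"
    by (rule order_le_less_trans) simp
next
  assume "conjugate (\<lambda>z. ereal (total_loss l inst \<xi>s z)) (- x) < \<infinity>"
  then obtain c where "conjugate (\<lambda>z. ereal (total_loss l inst \<xi>s z)) (- x) \<le> ereal c"
    by (cases "conjugate (\<lambda>z. ereal (total_loss l inst \<xi>s z)) (- x)") auto
  then have c: "z \<bullet> - x - total_loss l inst \<xi>s z \<le> c" for z
    by (subst (asm) conjugate_on_le_iff) auto
  show "x \<in> dual_domain l inst \<xi>s"
    unfolding dual_domain_def
  proof (intro CollectI ballI)
    fix i assume i: "i \<in> {1..l}"
    \<comment> \<open>The test vector vanishes off instance \<open>i\<close>, so the other losses
      contribute a constant.\<close>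
    define C where "C = c + (\<Sum>k\<in>{1..l}-{i}. \<xi>s k 0)"
    have "z \<bullet> block_part inst i (- x) - \<xi>s i z \<le> C" if z: "z \<in> block_space inst i" for z
    proof -
      have z': "block_part inst k z = (if k = i then z else 0)" for k
        using z by (auto simp: block_part_def block_space_def vec_eq_iff)
      have "total_loss l inst \<xi>s z = \<xi>s i z + (\<Sum>k\<in>{1..l}-{i}. \<xi>s k 0)"
        unfolding total_loss_def by (subst sum.remove[of _ i]) (use i in \<open>auto simp: z' intro!: sum.cong\<close>)
      moreover have "z \<bullet> - x = z \<bullet> block_part inst i (- x)"
        unfolding inner_block_part[OF inst, of z "- x"] by (subst sum.remove[of _ i]) (use i in \<open>auto simp: z'\<close>)
      ultimately show ?thesis using c[of z] by (simp add: C_def)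
    qed
    then have "conjugate_on (block_space inst i) (\<lambda>z. ereal (\<xi>s i z)) (block_part inst i (- x)) \<le> ereal C"
      by (subst conjugate_on_le_iff) auto
    then show "conjugate_on (block_space inst i) (\<lambda>z. ereal (\<xi>s i z)) (block_part inst i (- x)) < \<infinity>"
      by (rule order_le_less_trans) simp
  qed
qed

text \<open>Where the conjugate is infinite \<open>real_of_ereal\<close> yields 0, so the facts
  below are confined to its effective domain.\<close>

definition dual_loss :: "('a::real_inner \<Rightarrow> real) \<Rightarrow> 'a \<Rightarrow> real" where
  "dual_loss \<xi> x = real_of_ereal (conjugate (\<lambda>z. ereal (\<xi> z)) (- x))"

lemma conjugate_eq_dual_loss:
  assumes "conjugate (\<lambda>z. ereal (\<xi> z)) (- x) < \<infinity>"
  shows "conjugate (\<lambda>z. ereal (\<xi> z)) (- x) = ereal (dual_loss \<xi> x)"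
  unfolding dual_loss_def using conjugate_on_finite[of "\<lambda>z. ereal (\<xi> z)" 0 UNIV] assms by simp

lemma dual_loss_le_iff:
  assumes "conjugate (\<lambda>z. ereal (\<xi> z)) (- x) < \<infinity>"
  shows "dual_loss \<xi> x \<le> c \<longleftrightarrow> (\<forall>z. - (z \<bullet> x) - \<xi> z \<le> c)"
  using conjugate_on_le_iff[where h = "\<lambda>z. ereal (\<xi> z)" and V = UNIV and u = "- x" and c = c]
  unfolding conjugate_eq_dual_loss[OF assms] by simp

lemma convex_on_dual_loss:
  "convex_on {x. conjugate (\<lambda>z. ereal (\<xi> z)) (- x) < \<infinity>} (dual_loss \<xi>)"
proof -
  let ?S = "{x. conjugate (\<lambda>z. ereal (\<xi> z)) (- x) < \<infinity>}"
  \<comment> \<open>Bounding the conjugate itself, not \<open>dual_loss\<close>, gives finiteness at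
    the combination together with the inequality.\<close>
  have le: "conjugate (\<lambda>z. ereal (\<xi> z)) (- (u *\<^sub>R x + v *\<^sub>R y)) \<le> ereal (u * dual_loss \<xi> x + v * dual_loss \<xi> y)"
    if "x \<in> ?S" "y \<in> ?S" "0 \<le> u" "0 \<le> v" "u + v = 1" for x y u v
  proof -
    have "- (z \<bullet> (u *\<^sub>R x + v *\<^sub>R y)) - \<xi> z \<le> u * dual_loss \<xi> x + v * dual_loss \<xi> y" for z
    proof -
      have "- (z \<bullet> x) - \<xi> z \<le> dual_loss \<xi> x" "- (z \<bullet> y) - \<xi> z \<le> dual_loss \<xi> y"
        using dual_loss_le_iff that(1,2) by blast+
      then have "u * (- (z \<bullet> x) - \<xi> z) + v * (- (z \<bullet> y) - \<xi> z) \<le> u * dual_loss \<xi> x + v * dual_loss \<xi> y"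
        using that by (intro add_mono mult_left_mono)
      moreover have "u * \<xi> z + v * \<xi> z = \<xi> z" using that(5) by (simp flip: distrib_right)
      ultimately show ?thesis by (simp add: inner_add_right algebra_simps)
    qed
    then show ?thesis by (subst conjugate_on_le_iff) (simp_all only: inner_minus_right, simp_all)
  qed
  have "u *\<^sub>R x + v *\<^sub>R y \<in> ?S" if "x \<in> ?S" "y \<in> ?S" "0 \<le> u" "0 \<le> v" "u + v = 1" for x y u v
    unfolding mem_Collect_eq by (rule order_le_less_trans[OF le[OF that]]) simp
  then have cS: "convex ?S" unfolding convex_def by blast
  show ?thesis
    unfolding convex_on_def
  proof (intro conjI ballI allI impI)
    fix x y and u v :: real assume *: "x \<in> ?S" "y \<in> ?S" "0 \<le> u" "0 \<le> v" "u + v = 1"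
    then have "u *\<^sub>R x + v *\<^sub>R y \<in> ?S" using cS unfolding convex_def by blast
    then show "dual_loss \<xi> (u *\<^sub>R x + v *\<^sub>R y) \<le> u * dual_loss \<xi> x + v * dual_loss \<xi> y"
      using le[OF *] conjugate_eq_dual_loss[of \<xi> "u *\<^sub>R x + v *\<^sub>R y"] by simp
  qed (rule cS)
qed

text \<open>Testing the supremum at \<open>- (R *\<^sub>R sgn x)\<close>, in a ball on which
  continuity bounds \<xi>, gives growth at rate \<open>R\<close>. Such growth makes up for a
  singular \<open>B t\<close>.\<close>

lemma dual_loss_superlinear:
  fixes \<xi> :: "'a::euclidean_space \<Rightarrow> real"
  assumes "continuous_on UNIV \<xi>" and "0 \<le> R"
  shows "\<exists>C. \<forall>x. conjugate (\<lambda>z. ereal (\<xi> z)) (- x) < \<infinity> \<longrightarrow> R * norm x - C \<le> dual_loss \<xi> x"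
proof -
  have "compact (\<xi> ` cball 0 R)"
    by (intro compact_continuous_image continuous_on_subset[OF assms(1)]) auto
  then obtain C where C: "\<And>z. norm z \<le> R \<Longrightarrow> \<xi> z \<le> C"
    using compact_imp_bounded bounded_imp_bdd_above unfolding bdd_above_def by (metis image_eqI mem_cball_0)
  have "R * norm x - C \<le> dual_loss \<xi> x" if x: "conjugate (\<lambda>z. ereal (\<xi> z)) (- x) < \<infinity>" for x
  proof -
    let ?z = "- (R *\<^sub>R sgn x)"
    have "norm ?z \<le> R" using assms(2) by (simp add: norm_sgn)
    moreover have "- (?z \<bullet> x) = R * norm x"
      by (cases "x = 0") (simp_all add: sgn_div_norm dot_square_norm power2_eq_square)
    moreover have "- (?z \<bullet> x) - \<xi> ?z \<le> dual_loss \<xi> x" using dual_loss_le_iff[OF x, of "dual_loss \<xi> x"] by blast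
    ultimately show ?thesis using C[of ?z] by linarith
  qed
  then show ?thesis by blast
qed

section \<open>One iteration as an abstract quadratic model\<close>

text \<open>\<phi> stands for the dual loss, \<open>p\<close> for the gradient of \<open>G\<close>
  at the iterate \<open>x\<close>, and \<open>q\<close> for the form of \<open>B t\<close>, known
  only to be nonnegative and homogeneous of degree 2.\<close>

locale quadratic_model =
  fixes \<Omega> :: "'a::real_inner set" and \<phi> G q :: "'a \<Rightarrow> real" and p x :: 'a
  assumes \<phi>: "convex_on \<Omega> \<phi>" and x: "x \<in> \<Omega>"
    and tangent: "\<And>y. G x + p \<bullet> (y - x) \<le> G y"
    and q_scale: "\<And>s v. q (s *\<^sub>R v) = s\<^sup>2 * q v" and q_nonneg: "\<And>v. 0 \<le> q v"
begin

definition Q :: "'a \<Rightarrow> real" where "Q d = p \<bullet> d + q d / 2 + \<phi> (x + d)"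

text \<open>At the computed direction this is the predicted change of the backtracking test.\<close>

definition slope :: "'a \<Rightarrow> real" where "slope d = p \<bullet> d + \<phi> (x + d) - \<phi> x"

lemma q_zero: "q 0 = 0" using q_scale[of 0 0] by simp

lemma Q_zero: "Q 0 = \<phi> x" by (simp add: Q_def q_zero)

lemma Q_eq_slope: "Q d = Q 0 + slope d + q d / 2"
  unfolding Q_zero by (simp add: Q_def slope_def)

lemma segment:
  assumes "x + d \<in> \<Omega>" "0 \<le> \<theta>" "\<theta> \<le> 1"
  shows "x + \<theta> *\<^sub>R d \<in> \<Omega>" and "slope (\<theta> *\<^sub>R d) \<le> \<theta> * slope d"
proof -
  have eq: "x + \<theta> *\<^sub>R d = (1 - \<theta>) *\<^sub>R x + \<theta> *\<^sub>R (x + d)" by (simp add: algebra_simps)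
  show "x + \<theta> *\<^sub>R d \<in> \<Omega>"
    unfolding eq using assms x \<phi> by (intro convexD_alt) (auto simp: convex_on_def)
  have "\<phi> (x + \<theta> *\<^sub>R d) \<le> (1 - \<theta>) * \<phi> x + \<theta> * \<phi> (x + d)"
    unfolding eq using assms x by (intro convex_onD[OF \<phi>]) auto
  then show "slope (\<theta> *\<^sub>R d) \<le> \<theta> * slope d" by (simp add: slope_def algebra_simps)
qed

lemma Q_segment:
  assumes "x + d \<in> \<Omega>" "0 \<le> \<theta>" "\<theta> \<le> 1"
  shows "Q (\<theta> *\<^sub>R d) \<le> Q 0 + \<theta> * slope d + \<theta>\<^sup>2 * q d / 2"
  using segment(2)[OF assms] Q_eq_slope[of "\<theta> *\<^sub>R d"] by (simp add: q_scale)

text \<open>Moving from \<open>x\<close> towards a near-closest solution by the fraction \<open>\<mu> / 2\<close> optimizes the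
  quadratic upper bound \<open>-\<theta>\<delta> + \<theta>\<^sup>2\<delta> / \<mu>\<close> of the model decrease; \<open>\<mu> \<le> 2\<close> keeps that
  point on the segment.\<close>

lemma model_decrease:
  assumes \<mu>: "0 < \<mu>" "\<mu> \<le> 2"
    and growth: "\<And>\<epsilon>. 0 < \<epsilon> \<Longrightarrow> \<exists>y\<in>\<Omega>. G y + \<phi> y \<le> F \<and> \<mu> / 2 * q (y - x) \<le> G x + \<phi> x - F + \<epsilon>"
    and low: "\<And>d. x + d \<in> \<Omega> \<Longrightarrow> m \<le> Q d"
  shows "m - Q 0 \<le> - (\<mu> * (G x + \<phi> x - F) / 4)"
proof (rule field_le_epsilon)
  define \<delta> where "\<delta> = G x + \<phi> x - F"
  fix e :: real assume e: "e > 0"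
  \<comment> \<open>The tolerance is chosen to become exactly \<open>e\<close> after multiplication
    by \<mu>/4, the factor that turns the growth bound into the quadratic term at \<theta> =
    \<mu>/2.\<close>
  obtain y where y: "y \<in> \<Omega>" "G y + \<phi> y \<le> F" "\<mu> / 2 * q (y - x) \<le> \<delta> + 4 * e / \<mu>"
    using growth[of "4 * e / \<mu>"] e \<mu> by (auto simp: \<delta>_def)
  have yS: "x + (y - x) \<in> \<Omega>" using y(1) by simp
  have "slope (y - x) \<le> - \<delta>" using tangent[of y] y(2) by (simp add: slope_def \<delta>_def)
  then have 1: "\<mu> / 2 * slope (y - x) \<le> \<mu> / 2 * (- \<delta>)" using \<mu> by (intro mult_left_mono) auto
  have "(\<mu> / 4) * (\<mu> / 2 * q (y - x)) \<le> (\<mu> / 4) * (\<delta> + 4 * e / \<mu>)"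
    using y(3) \<mu> by (intro mult_left_mono) auto
  also have "\<dots> = \<mu> * \<delta> / 4 + e" using \<mu> by (simp add: field_simps)
  finally have 2: "(\<mu> / 2)\<^sup>2 * q (y - x) / 2 \<le> \<mu> * \<delta> / 4 + e" by (simp add: power2_eq_square)
  have "m \<le> Q ((\<mu> / 2) *\<^sub>R (y - x))"
    using segment(1)[OF yS, of "\<mu> / 2"] \<mu> by (intro low) auto
  also have "\<dots> \<le> Q 0 + \<mu> / 2 * slope (y - x) + (\<mu> / 2)\<^sup>2 * q (y - x) / 2"
    using Q_segment[OF yS, of "\<mu> / 2"] \<mu> by auto
  finally show "m - Q 0 \<le> - (\<mu> * \<delta> / 4) + e" using 1 2 by (simp add: algebra_simps)
qed

context
  fixes d and m \<gamma> :: real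
  assumes d: "x + d \<in> \<Omega>" and \<gamma>: "0 \<le> \<gamma>" "\<gamma> < 1"
    and low: "\<And>d. x + d \<in> \<Omega> \<Longrightarrow> m \<le> Q d"
    and approx: "Q d - m \<le> \<gamma> * (Q 0 - m)"
begin

lemma slope_le_model_decrease: "slope d \<le> (1 - \<gamma>) * (m - Q 0)"
  using approx Q_eq_slope[of d] q_nonneg[of d] by (simp add: algebra_simps)

lemma slope_curvature: "q d / (1 + sqrt \<gamma>) \<le> - slope d"
proof (rule approx_minimizer_curvature[OF \<gamma> q_nonneg])
  show "m - Q 0 \<le> \<theta> * slope d + \<theta>\<^sup>2 * q d / 2" if "0 \<le> \<theta>" "\<theta> \<le> 1" for \<theta>
    using Q_segment[OF d that] low[OF segment(1)[OF d that]] by simp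
  show "slope d + q d / 2 \<le> (1 - \<gamma>) * (m - Q 0)"
    using approx Q_eq_slope[of d] by (simp add: algebra_simps)
qed

text \<open>The smoothness error is of second order in \<open>s\<close>;
  \<open>slope_curvature\<close> and the upper limit on \<open>s\<close> bound it by the share 1 -
  \<tau> of the first-order decrease. As \<open>s\<close> is at most 1, the trial stays where
  \<open>smooth\<close> applies.\<close>

lemma small_step_decrease:
  assumes L: "0 < L" and \<tau>: "\<tau> < 1"
    and s: "0 < s" "s \<le> 1" "s \<le> 2 * (1 - \<tau>) / (L * (1 + sqrt \<gamma>))"
    and smooth: "\<And>y. y \<in> \<Omega> \<Longrightarrow> norm (y - x) \<le> norm d \<Longrightarrow> G y \<le> G x + p \<bullet> (y - x) + L / 2 * q (y - x)"
  shows "G (x + s *\<^sub>R d) + \<phi> (x + s *\<^sub>R d) \<le> G x + \<phi> x + s * \<tau> * slope d"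
proof -
  have sd: "x + s *\<^sub>R d \<in> \<Omega>" "slope (s *\<^sub>R d) \<le> s * slope d" using segment[OF d] s by auto
  have "G (x + s *\<^sub>R d) \<le> G x + p \<bullet> (s *\<^sub>R d) + L / 2 * (s\<^sup>2 * q d)"
    using smooth[OF sd(1)] s by (simp add: q_scale mult_left_le_one_le)
  moreover have "L / 2 * (s\<^sup>2 * q d) \<le> s * (1 - \<tau>) * (- slope d)"
  proof -
    define R where "R = 1 + sqrt \<gamma>"
    have r: "0 < R" using \<gamma> by (simp add: R_def add_pos_nonneg)
    have "L / 2 * s \<le> L / 2 * (2 * (1 - \<tau>) / (L * (1 + sqrt \<gamma>)))"
      using s(3) L by (intro mult_left_mono) auto
    also have "\<dots> = (1 - \<tau>) / (1 + sqrt \<gamma>)"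
      using L r unfolding R_def[symmetric] by (simp add: field_simps)
    finally have "L / 2 * s \<le> (1 - \<tau>) / (1 + sqrt \<gamma>)" .
    then have "s * (L / 2 * s * q d) \<le> s * ((1 - \<tau>) / (1 + sqrt \<gamma>) * q d)"
      using s(1) q_nonneg by (intro mult_left_mono mult_right_mono) auto
    also have "\<dots> \<le> s * ((1 - \<tau>) * (- slope d))"
      using mult_left_mono[OF slope_curvature, of "1 - \<tau>"] s(1) \<tau> by (intro mult_left_mono) auto
    finally show ?thesis by (simp add: power2_eq_square algebra_simps)
  qed
  ultimately show ?thesis using sd(2) by (simp add: slope_def algebra_simps)
qed

end

end

section \<open>Concrete ingredients: lower bounds, gradients and weak duality\<close>

text \<open>Growth of the dual loss at rate \<open>norm p\<close> absorbs the linear term, even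
  along directions where \<open>q\<close> vanishes.\<close>

lemma quadratic_model_bounded_below:
  fixes \<xi> :: "'a::euclidean_space \<Rightarrow> real"
  assumes "continuous_on UNIV \<xi>" and "\<And>v. 0 \<le> q v"
  shows "\<exists>c. \<forall>d. conjugate (\<lambda>z. ereal (\<xi> z)) (- (x + d)) < \<infinity> \<longrightarrow> c \<le> p \<bullet> d + q d / 2 + dual_loss \<xi> (x + d)"
proof -
  obtain C where C: "\<And>y. conjugate (\<lambda>z. ereal (\<xi> z)) (- y) < \<infinity> \<Longrightarrow> norm p * norm y - C \<le> dual_loss \<xi> y"
    using dual_loss_superlinear[OF assms(1), of "norm p"] by auto
  have "- (norm p * norm x) - C \<le> p \<bullet> d + q d / 2 + dual_loss \<xi> (x + d)"
    if "conjugate (\<lambda>z. ereal (\<xi> z)) (- (x + d)) < \<infinity>" for d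
  proof -
    have "- (p \<bullet> d) \<le> norm p * norm d" using norm_cauchy_schwarz[of "-p" d] by simp
    also have "\<dots> \<le> norm p * (norm (x + d) + norm x)"
      using norm_triangle_ineq4[of "x + d" x] by (intro mult_left_mono) auto
    finally show ?thesis using C[OF that] assms(2)[of d] by (simp add: algebra_simps)
  qed
  then show ?thesis by blast
qed

text \<open>Adding the tangent inequalities at \<open>u\<close> and \<open>v\<close> gives
  monotonicity. For \<open>G_star\<close> the gradient is pulled back by the transpose of
  \<open>X\<close>, and boundedness of \<open>X\<close> keeps the remainder quadratic, as
  \<open>grad_eqI\<close> requires.\<close>

lemma g_star_smooth:
  fixes g :: "real^'n \<Rightarrow> ereal" and X :: "real^'m::finite^'n"
  assumes sc: "strongly_convex \<sigma> g" "\<sigma> > 0" and g: "\<And>w. g w \<noteq> -\<infinity>"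
    and fin: "\<And>u. conjugate g u = ereal (g_star g u)"
  shows "0 \<le> (grad (g_star g) v - grad (g_star g) u) \<bullet> (v - u)"
    and "G_star g X x + grad (G_star g X) x \<bullet> (y - x) \<le> G_star g X y"
proof -
  obtain D where D: "\<And>u v. g_star g u + D u \<bullet> (v - u) \<le> g_star g v"
      "\<And>u v. g_star g v \<le> g_star g u + D u \<bullet> (v - u) + (norm (v - u))\<^sup>2 / (2 * \<sigma>)"
    using strongly_convex_conjugate_quadratic_bounds[where gs = "g_star g", OF sc g fin] by metis
  have grad: "grad (g_star g) u = D u" for u
  proof (rule grad_eqI)
    show "\<bar>g_star g v - g_star g u - D u \<bullet> (v - u)\<bar> \<le> 1 / (2 * \<sigma>) * (norm (v - u))\<^sup>2" for v
      using D[where v = v and u = u] by simp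
  qed
  show "0 \<le> (grad (g_star g) v - grad (g_star g) u) \<bullet> (v - u)"
    unfolding grad using D(1)[where u = u and v = v] D(1)[where u = v and v = u]
    by (simp add: algebra_simps)
  define p where "p = transpose X *v D (X *v x)"
  have p: "p \<bullet> (z - x) = D (X *v x) \<bullet> (X *v z - X *v x)" for z
    unfolding p_def by (simp add: dot_lmul_matrix transpose_matrix_vector matrix_vector_mult_diff_distrib)
  obtain k where k: "\<And>z. norm (X *v z) \<le> norm z * k"
    using bounded_linear.bounded[OF matrix_vector_mul_bounded_linear[of X]] by auto
  have "grad (G_star g X) x = p"
  proof (rule grad_eqI)
    fix z
    have "(norm (X *v z - X *v x))\<^sup>2 \<le> (norm (z - x) * k)\<^sup>2"
      using k[of "z - x"] by (intro power_mono) (auto simp: matrix_vector_mult_diff_distrib)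
    then have "(norm (X *v z - X *v x))\<^sup>2 / (2 * \<sigma>) \<le> k\<^sup>2 / (2 * \<sigma>) * (norm (z - x))\<^sup>2"
      using sc(2) by (simp add: divide_right_mono power_mult_distrib mult.commute)
    then show "\<bar>G_star g X z - G_star g X x - p \<bullet> (z - x)\<bar> \<le> k\<^sup>2 / (2 * \<sigma>) * (norm (z - x))\<^sup>2"
      unfolding p G_star_def using D[where u = "X *v x" and v = "X *v z"] by simp
  qed
  then show "G_star g X x + grad (G_star g X) x \<bullet> (y - x) \<le> G_star g X y"
    using D(1)[where u = "X *v x" and v = "X *v y"] p[of y] by (simp add: G_star_def)
qed

text \<open>On the unit ball around \<open>w0\<close> the loss is bounded above, so the primal lower
  bound \<open>P\<close> becomes a lower bound on \<open>g\<close> there.\<close>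

lemma primal_imp_conjugate_finite:
  fixes g :: "real^'n \<Rightarrow> ereal" and X :: "real^'m::finite^'n"
  assumes sc: "strongly_convex \<sigma> g" "\<sigma> > 0" and g: "\<And>w. g w \<noteq> -\<infinity>" and w0: "g w0 < \<infinity>"
    and cont: "continuous_on UNIV \<xi>"
    and P: "\<And>w. ereal P \<le> g w + ereal (\<xi> (transpose X *v w))"
  shows "conjugate g u = ereal (g_star g u)"
proof -
  have "compact ((\<lambda>w. \<xi> (transpose X *v w)) ` cball w0 1)"
    by (intro compact_continuous_image continuous_on_compose2[OF cont]
        linear_continuous_on matrix_vector_mul_bounded_linear) auto
  then obtain C where C: "\<And>w. w \<in> cball w0 1 \<Longrightarrow> \<xi> (transpose X *v w) \<le> C"
    using compact_imp_bounded bounded_imp_bdd_above unfolding bdd_above_def by (metis image_eqI)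
  have "ereal (P - C) \<le> g w" if "w \<in> cball w0 1" for w
    using P[of w] C[OF that] g[of w] by (cases "g w") auto
  then have "conjugate g u < \<infinity>"
    by (rule strongly_convex_conjugate_finite[where g = g, OF sc g w0])
  then show ?thesis
    unfolding g_star_def using w0 g by (intro conjugate_on_finite[symmetric]) auto
qed

text \<open>The Fenchel-Young inequalities for \<open>g\<close> and for the loss are added; their
  inner products cancel.\<close>

lemma weak_duality:
  fixes g :: "real^'n \<Rightarrow> ereal" and X :: "real^'m::finite^'n"
  assumes g: "\<And>w. g w \<noteq> -\<infinity>" and fin: "\<And>u. conjugate g u = ereal (g_star g u)"
    and w: "g w + ereal (\<xi> (transpose X *v w)) \<le> ereal P"
    and x: "conjugate (\<lambda>z. ereal (\<xi> z)) (- x) < \<infinity>"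
  shows "- P \<le> G_star g X x + dual_loss \<xi> x"
proof -
  obtain c where c: "g w = ereal c" using g[of w] w by (cases "g w") auto
  have "w \<bullet> (X *v x) - c \<le> G_star g X x"
  proof -
    have "\<forall>z\<in>UNIV. g z < \<infinity> \<longrightarrow> z \<bullet> (X *v x) - real_of_ereal (g z) \<le> G_star g X x"
      using fin by (subst conjugate_on_le_iff[symmetric]) (auto simp: g G_star_def)
    from this[rule_format, of w] show ?thesis by (simp add: c)
  qed
  moreover have "- ((transpose X *v w) \<bullet> x) - \<xi> (transpose X *v w) \<le> dual_loss \<xi> x"
    using dual_loss_le_iff[OF x, of "dual_loss \<xi> x"] by blast
  moreover have "(transpose X *v w) \<bullet> x = w \<bullet> (X *v x)"
    by (simp add: dot_lmul_matrix transpose_matrix_vector)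
  ultimately show ?thesis using w c by simp
qed

section \<open>Convergence of the block-diagonal method\<close>

theorem theorem4:
  fixes l K :: nat
    and inst :: "'m::{finite,linorder} \<Rightarrow> nat"
    and mach :: "nat \<Rightarrow> nat"
    and X :: "real^'m::{finite,linorder}^'n"
    and g :: "real^'n \<Rightarrow> ereal"
    and \<xi>s :: "nat \<Rightarrow> real^'m::{finite,linorder} \<Rightarrow> real"
    and \<xi> :: "real^'m::{finite,linorder} \<Rightarrow> real"
    and f :: "real^'m::{finite,linorder} \<Rightarrow> ereal"
    and fopt :: ereal
    and \<Omega> A :: "(real^'m::{finite,linorder}) set"
    and \<sigma> L\<^sub>B \<mu>\<^sub>B \<gamma> \<beta> \<tau> :: real
    and a1 a2 \<eta> r :: "nat \<Rightarrow> real"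
    and M :: "nat \<Rightarrow> real^'n^'n"
    and B :: "nat \<Rightarrow> real^'m::{finite,linorder}^'m::{finite,linorder}"
    and \<alpha> \<Delta> :: "nat \<Rightarrow> real^'m::{finite,linorder}"
  assumes inst: "mono inst" "range inst = {1..l}"
    and mach: "mono_on {1..l} mach" "mach ` {1..l} = {1..K}"
    and g_strongly_convex: "\<sigma> > 0" "strongly_convex \<sigma> g"
    and loss_convex: "\<And>i. i \<in> {1..l} \<Longrightarrow> convex_on (block_space inst i) (\<xi>s i)"
    and primal: "proper_closed_convex (primal_obj l inst \<xi>s g X)"
    and primal_solution: "\<exists>w. \<forall>v. primal_obj l inst \<xi>s g X w \<le> primal_obj l inst \<xi>s g X v"
    and \<xi>: "\<xi> = total_loss l inst \<xi>s"
    and standing: "(\<exists>\<rho>>0. (\<forall>z. \<xi> differentiable (at z)) \<and> \<rho>-lipschitz_on UNIV (grad \<xi>))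
                   \<or> (\<exists>L>0. L-lipschitz_on UNIV \<xi>)"
    and \<Omega>: "\<Omega> = dual_domain l inst \<xi>s"
    and f: "f = dual_obj g X \<xi>"
    and fopt: "fopt = (INF x\<in>\<Omega>. f x)"
    and A: "A = {x \<in> \<Omega>. \<forall>y\<in>\<Omega>. f x \<le> f y}"
    and parameters: "0 \<le> \<gamma>" "\<gamma> < 1" "0 < \<beta>" "\<beta> < 1" "0 < \<tau>" "\<tau> < 1"
    and constants: "L\<^sub>B > 0" "\<mu>\<^sub>B > 0" "\<mu>\<^sub>B \<le> 2"
    and start: "\<alpha> 0 \<in> \<Omega>"
    and weights: "\<And>t. a1 t \<ge> 0" "\<And>t. a2 t \<ge> 0" "\<And>t. \<not> (a1 t = 0 \<and> a2 t = 0)"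
    and hessian: "\<And>t. M t \<in> gen_hessian (g_star g) (X *v \<alpha> t)"
    and B: "\<And>t. B t = a1 t *\<^sub>R block_diag (\<lambda>j. mach (inst j)) (transpose X ** M t ** X) + a2 t *\<^sub>R mat 1"
    and direction: "\<And>t. approx_minimizer \<gamma> (subproblem_obj g X \<xi> (\<alpha> t) (B t)) (\<Delta> t)"
    and step: "(\<forall>t. backtracking_step g X \<xi> \<beta> \<tau> (\<alpha> t) (\<Delta> t) (\<eta> t))
               \<or> (\<forall>t. exact_step g X \<xi> (\<alpha> t) (\<Delta> t) (\<eta> t))"
    and update: "\<And>t. \<alpha> (Suc t) = \<alpha> t + \<eta> t *\<^sub>R \<Delta> t"
    \<comment> \<open>In (a), ``close enough to \<open>\<alpha> t\<close>'' means within a radius that covers the segment from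
        \<open>\<alpha> t\<close> to \<open>\<alpha> t + \<Delta> t\<close> searched by backtracking; with an arbitrary radius the rate is false.\<close>
    and radius: "\<And>t. 0 < r t" "\<And>t. norm (\<Delta> t) \<le> r t"
    and assm_a: "\<And>t x. x \<in> \<Omega> \<Longrightarrow> norm (x - \<alpha> t) \<le> r t \<Longrightarrow>
        G_star g X x \<le> G_star g X (\<alpha> t) + grad (G_star g X) (\<alpha> t) \<bullet> (x - \<alpha> t)
                        + L\<^sub>B / 2 * (bnorm (B t) (x - \<alpha> t))\<^sup>2"
    and assm_b: "\<And>t x. x \<in> \<Omega> \<Longrightarrow>
        f x - fopt \<ge> ereal (\<mu>\<^sub>B / 2) * (INF y\<in>A. ereal ((bnorm (B t) (x - y))\<^sup>2))"
  shows "q_linear (\<lambda>t. f (\<alpha> t)) fopt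
    \<and> ((\<forall>t. backtracking_step g X \<xi> \<beta> \<tau> (\<alpha> t) (\<Delta> t) (\<eta> t)) \<longrightarrow>
        (\<forall>t. (f (\<alpha> t) \<noteq> fopt \<longrightarrow>
               (f (\<alpha> (Suc t)) - fopt) / (f (\<alpha> t) - fopt) \<le> ereal (1 - \<tau> * \<mu>\<^sub>B * (1 - \<gamma>) * \<eta> t / 4))
             \<and> 1 - \<tau> * \<mu>\<^sub>B * (1 - \<gamma>) * \<eta> t / 4
                 \<le> 1 - \<tau> * \<mu>\<^sub>B / 2 * min ((1 - \<gamma>) / 2) (\<beta> * (1 - \<tau>) * (1 - sqrt \<gamma>) / L\<^sub>B)))
    \<and> ((\<forall>t. exact_step g X \<xi> (\<alpha> t) (\<Delta> t) (\<eta> t)) \<longrightarrow>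
        \<comment> \<open>For exact line search the middle term holds with the backtracking step \<open>s\<close> along
            \<open>\<Delta> t\<close>, but not with the exact step, which can be arbitrarily large or small.\<close>
        (\<forall>t. \<exists>s. backtracking_step g X \<xi> \<beta> \<tau> (\<alpha> t) (\<Delta> t) s
             \<and> (f (\<alpha> t) \<noteq> fopt \<longrightarrow>
               (f (\<alpha> (Suc t)) - fopt) / (f (\<alpha> t) - fopt) \<le> ereal (1 - \<tau> * \<mu>\<^sub>B * (1 - \<gamma>) * s / 4))
             \<and> 1 - \<tau> * \<mu>\<^sub>B * (1 - \<gamma>) * s / 4
                 \<le> 1 - \<tau> * \<mu>\<^sub>B / 2 * min ((1 - \<gamma>) / 2) (\<beta> * (1 - \<tau>) * (1 - sqrt \<gamma>) / L\<^sub>B)))"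
proof -
  define G where "G = G_star g X"
  define \<phi> where "\<phi> = dual_loss \<xi>"
  define F where "F y = G y + \<phi> y" for y
  define c where "c = 2 * (1 - \<tau>) / (L\<^sub>B * (1 + sqrt \<gamma>))"
  define rate where "rate = 1 - \<tau> * \<mu>\<^sub>B / 2 * min ((1 - \<gamma>) / 2) (\<beta> * (1 - \<tau>) * (1 - sqrt \<gamma>) / L\<^sub>B)"
  have primal_eq: "primal_obj l inst \<xi>s g X w = g w + ereal (\<xi> (transpose X *v w))" for w
    unfolding primal_obj_def \<xi> total_loss_def ..
  \<comment> \<open>Both alternatives of \<open>standing\<close> imply continuity, hence boundedness
    of the loss on balls.\<close>
  have cont: "continuous_on UNIV \<xi>"
    using standing lipschitz_on_continuous_on continuous_at_imp_continuous_on differentiable_imp_continuous_within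
    by metis
  have g: "g w \<noteq> -\<infinity>" for w
    using primal unfolding proper_closed_convex_def primal_eq by (metis plus_ereal.simps(5) ereal.distinct(3) ereal_plus_eq_MInfty)
  obtain w0 where w0: "primal_obj l inst \<xi>s g X w0 \<noteq> \<infinity>"
    using primal unfolding proper_closed_convex_def by blast
  obtain w P where w: "primal_obj l inst \<xi>s g X w = ereal P" "\<And>v. ereal P \<le> primal_obj l inst \<xi>s g X v"
  proof -
    obtain w where w: "\<And>v. primal_obj l inst \<xi>s g X w \<le> primal_obj l inst \<xi>s g X v"
      using primal_solution by blast
    then have "primal_obj l inst \<xi>s g X w \<noteq> \<infinity>" using w0 by (metis ereal_infty_less_eq(1))
    moreover have "primal_obj l inst \<xi>s g X w \<noteq> -\<infinity>" using primal by (simp add: proper_closed_convex_def)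
    ultimately show ?thesis using that w by (cases "primal_obj l inst \<xi>s g X w") auto
  qed
  have "g w0 < \<infinity>" using w0 unfolding primal_eq by auto
  then have fin: "conjugate g u = ereal (g_star g u)" for u
    using primal_imp_conjugate_finite[where g = g, OF g_strongly_convex(2,1) g _ cont w(2)[unfolded primal_eq]] by blast
  note smooth = g_star_smooth[where g = g, OF g_strongly_convex(2,1) g fin]
  have tangent: "G x + grad G x \<bullet> (y - x) \<le> G y" for x y
    unfolding G_def by (rule smooth(2))
  have \<Omega>_eq: "\<Omega> = {x. conjugate (\<lambda>z. ereal (\<xi> z)) (- x) < \<infinity>}"
    unfolding \<Omega> \<xi> using dual_domain_iff[OF inst(2)] by blast
  have conj: "conjugate (\<lambda>z. ereal (\<xi> z)) (- y) = (if y \<in> \<Omega> then ereal (\<phi> y) else \<infinity>)" for y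
    unfolding \<Omega>_eq \<phi>_def using conjugate_eq_dual_loss by auto
  have f_eq: "f y = (if y \<in> \<Omega> then ereal (F y) else \<infinity>)" for y
    unfolding f dual_obj_def fin conj F_def G_def G_star_def by auto
  have convex: "convex_on \<Omega> \<phi>" unfolding \<Omega>_eq \<phi>_def by (rule convex_on_dual_loss)

  \<comment> \<open>Weak duality at the primal solution bounds the dual from below and the starting
    point bounds it from above, so \<open>fopt\<close> is real.\<close>
  have "- P \<le> F y" if "y \<in> \<Omega>" for y
    unfolding F_def G_def \<phi>_def
    using weak_duality[where g = g and w = w and \<xi> = \<xi> and P = P and x = y, OF g fin] w(1) that
    unfolding primal_eq \<Omega>_eq by auto
  then have "ereal (- P) \<le> fopt" unfolding fopt by (intro INF_greatest) (simp add: f_eq)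
  moreover have fopt_le: "fopt \<le> ereal (F y)" if "y \<in> \<Omega>" for y
    unfolding fopt using that by (intro INF_lower2[OF that]) (simp add: f_eq)
  ultimately obtain Fo where Fo: "fopt = ereal Fo"
    using start by (cases fopt) auto
  have Fo_le: "Fo \<le> F y" if "y \<in> \<Omega>" for y using fopt_le[OF that] Fo by simp
  have A_le: "y \<in> \<Omega> \<and> F y \<le> Fo" if "y \<in> A" for y
  proof -
    have "f y \<le> fopt" unfolding fopt using that by (intro INF_greatest) (simp add: A)
    then show ?thesis using that Fo f_eq by (simp add: A)
  qed

  define q where "q t v = v \<bullet> (B t *v v)" for t v
  have q_nonneg: "0 \<le> q t v" for t v
    unfolding q_def B
    by (rule block_diag_gram_nonneg[OF gen_hessian_nonneg[OF smooth(1) hessian] weights(1,2)])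
  have q_scale: "q t (s *\<^sub>R v) = s\<^sup>2 * q t v" for t s v
    by (simp add: q_def matrix_vector_mult_scaleR power2_eq_square)
  \<comment> \<open>\<open>sqrt\<close> is an odd function, so squaring returns the form only where
    the form is nonnegative.\<close>
  have bnorm: "(bnorm (B t) v)\<^sup>2 = q t v" for t v
    using q_nonneg by (simp add: bnorm_def q_def)
  have model: "quadratic_model \<Omega> \<phi> G (q t) (grad G (\<alpha> t)) (\<alpha> t)" if "\<alpha> t \<in> \<Omega>" for t
    using convex that tangent q_scale q_nonneg by unfold_locales

  \<comment> \<open>The slack \<epsilon> stands in for attainment of the infimum in (b). The
    contradiction also covers an empty \<open>A\<close>, whose infimum is \<infinity>, so dual
    solvability comes out of (b).\<close>
  have growth: "\<exists>y\<in>\<Omega>. F y \<le> Fo \<and> \<mu>\<^sub>B / 2 * q t (y - x) \<le> F x - Fo + \<epsilon>"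
    if x: "x \<in> \<Omega>" and \<epsilon>: "0 < \<epsilon>" for t x \<epsilon>
  proof (rule ccontr)
    assume "\<not> ?thesis"
    then have far: "F x - Fo + \<epsilon> < \<mu>\<^sub>B / 2 * q t (y - x)" if "y \<in> A" for y
      using A_le[OF that] by force
    have "ereal ((F x - Fo + \<epsilon>) / (\<mu>\<^sub>B / 2)) \<le> (INF y\<in>A. ereal ((bnorm (B t) (x - y))\<^sup>2))"
    proof (rule INF_greatest)
      fix y assume "y \<in> A"
      have "q t (x - y) = q t (y - x)" using q_scale[of t "-1" "x - y"] by simp
      then show "ereal ((F x - Fo + \<epsilon>) / (\<mu>\<^sub>B / 2)) \<le> ereal ((bnorm (B t) (x - y))\<^sup>2)"
        unfolding bnorm using far[OF \<open>y \<in> A\<close>] constants(2) by (simp add: field_simps)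
    qed
    then have "ereal (\<mu>\<^sub>B / 2) * ereal ((F x - Fo + \<epsilon>) / (\<mu>\<^sub>B / 2)) \<le> f x - fopt"
      using assm_b[OF x, of t] constants(2) by (meson ereal_mult_left_mono ereal_less_eq(5) less_imp_le half_gt_zero order_trans)
    then show False using x \<epsilon> constants(2) by (simp add: f_eq Fo)
  qed

  define pred where "pred t = grad G (\<alpha> t) \<bullet> \<Delta> t + \<phi> (\<alpha> t + \<Delta> t) - \<phi> (\<alpha> t)" for t
  have iter: "\<alpha> t + \<Delta> t \<in> \<Omega>"
      "pred t \<le> - ((1 - \<gamma>) * \<mu>\<^sub>B * (F (\<alpha> t) - Fo) / 4)"
      "\<And>s. 0 < s \<Longrightarrow> s \<le> 1 \<Longrightarrow> s \<le> c \<Longrightarrow>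
        \<alpha> t + s *\<^sub>R \<Delta> t \<in> \<Omega> \<and> F (\<alpha> t + s *\<^sub>R \<Delta> t) \<le> F (\<alpha> t) + s * \<tau> * pred t"
    if x: "\<alpha> t \<in> \<Omega>" for t
  proof -
    interpret quadratic_model \<Omega> \<phi> G "q t" "grad G (\<alpha> t)" "\<alpha> t" by (rule model[OF x])
    have Q_eq: "subproblem_obj g X \<xi> (\<alpha> t) (B t) d = (if \<alpha> t + d \<in> \<Omega> then ereal (Q d) else \<infinity>)" for d
    proof -
      have "- \<alpha> t - d = - (\<alpha> t + d)" by simp
      then show ?thesis unfolding subproblem_obj_def Q_def q_def G_def[symmetric] by (simp only: conj) auto
    qed
    define I where "I = (INF d. subproblem_obj g X \<xi> (\<alpha> t) (B t) d)"
    \<comment> \<open>\<open>B t\<close> may be singular, so a finite infimum rests on the growth of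
      the dual loss.\<close>
    obtain b where "\<And>d. \<alpha> t + d \<in> \<Omega> \<Longrightarrow> b \<le> Q d"
      using quadratic_model_bounded_below[where q = "q t" and x = "\<alpha> t" and p = "grad G (\<alpha> t)", OF cont q_nonneg]
      unfolding Q_def unfolding \<phi>_def \<Omega>_eq mem_Collect_eq by blast
    then have "ereal b \<le> I" unfolding I_def by (intro INF_greatest) (simp add: Q_eq)
    moreover have I_le: "I \<le> subproblem_obj g X \<xi> (\<alpha> t) (B t) d" for d
      unfolding I_def by (intro INF_lower) auto
    moreover have Q0: "subproblem_obj g X \<xi> (\<alpha> t) (B t) 0 = ereal (Q 0)" using x by (simp add: Q_eq)
    ultimately obtain m where m: "I = ereal m" by (cases I) (auto dest: order_trans[OF _ I_le[of 0]])
    have low: "m \<le> Q d" if "\<alpha> t + d \<in> \<Omega>" for d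
      using I_le[of d] that m by (simp add: Q_eq)
    have appr: "subproblem_obj g X \<xi> (\<alpha> t) (B t) (\<Delta> t) - ereal m \<le> ereal (\<gamma> * (Q 0 - m))"
      using direction[of t] unfolding approx_minimizer_def I_def[symmetric] m Q0 by simp
    \<comment> \<open>Off \<Omega> the model value is \<infinity>, which the real right-hand side of
      \<open>appr\<close> excludes.\<close>
    then show D: "\<alpha> t + \<Delta> t \<in> \<Omega>" by (auto simp: Q_eq split: if_splits)
    then have approx: "Q (\<Delta> t) - m \<le> \<gamma> * (Q 0 - m)" using appr by (simp add: Q_eq)
    have sl: "slope (\<Delta> t) = pred t"
      unfolding pred_def slope_def ..
    have "m - Q 0 \<le> - (\<mu>\<^sub>B * (G (\<alpha> t) + \<phi> (\<alpha> t) - Fo) / 4)"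
      using growth[OF x] by (intro model_decrease[OF constants(2,3)] low) (auto simp: F_def)
    then have "(1 - \<gamma>) * (m - Q 0) \<le> (1 - \<gamma>) * (- (\<mu>\<^sub>B * (F (\<alpha> t) - Fo) / 4))"
      unfolding F_def using parameters(2) by (intro mult_left_mono) auto
    then show "pred t \<le> - ((1 - \<gamma>) * \<mu>\<^sub>B * (F (\<alpha> t) - Fo) / 4)"
      using slope_le_model_decrease[OF D parameters(1,2) low approx] unfolding sl by simp
    fix s :: real assume s: "0 < s" "s \<le> 1" "s \<le> c"
    have "G (\<alpha> t + s *\<^sub>R \<Delta> t) + \<phi> (\<alpha> t + s *\<^sub>R \<Delta> t) \<le> G (\<alpha> t) + \<phi> (\<alpha> t) + s * \<tau> * pred t"
      unfolding sl[symmetric]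
    proof (rule small_step_decrease[OF D parameters(1,2) low approx constants(1) parameters(6) s(1,2) s(3)[unfolded c_def]])
      \<comment> \<open>Assumption (a) applies because \<open>r t\<close> is at least the length of
        the direction.\<close>
      fix y assume "y \<in> \<Omega>" "norm (y - \<alpha> t) \<le> norm (\<Delta> t)"
      then show "G y \<le> G (\<alpha> t) + grad G (\<alpha> t) \<bullet> (y - \<alpha> t) + L\<^sub>B / 2 * q t (y - \<alpha> t)"
        using assm_a[of y t] radius(2)[of t] unfolding G_def bnorm by simp
    qed
    then show "\<alpha> t + s *\<^sub>R \<Delta> t \<in> \<Omega> \<and> F (\<alpha> t + s *\<^sub>R \<Delta> t) \<le> F (\<alpha> t) + s * \<tau> * pred t"
      using segment(1)[OF D, of s] s by (simp add: F_def)
  qed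

  have suff: "sufficient_decrease g X \<xi> \<tau> (\<alpha> t) (\<Delta> t) s \<longleftrightarrow>
      \<alpha> t + s *\<^sub>R \<Delta> t \<in> \<Omega> \<and> F (\<alpha> t + s *\<^sub>R \<Delta> t) \<le> F (\<alpha> t) + s * \<tau> * pred t" if x: "\<alpha> t \<in> \<Omega>" for t s
  proof -
    have "- \<alpha> t - \<Delta> t = - (\<alpha> t + \<Delta> t)" by simp
    then have "predicted_change g X \<xi> (\<alpha> t) (\<Delta> t) = ereal (pred t)"
      unfolding predicted_change_def G_def[symmetric] pred_def using x iter(1)[OF x] by (simp only: conj) simp
    then show ?thesis unfolding sufficient_decrease_def f[symmetric] using x by (simp add: f_eq)
  qed

  have c: "0 < c" unfolding c_def using parameters constants by (simp add: add_pos_nonneg)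
  have bt_ex: "\<exists>s. backtracking_step g X \<xi> \<beta> \<tau> (\<alpha> t) (\<Delta> t) s" if x: "\<alpha> t \<in> \<Omega>" for t
    using backtracking_exponent[OF parameters(3,4) c, of "sufficient_decrease g X \<xi> \<tau> (\<alpha> t) (\<Delta> t)"]
      iter(3)[OF x] suff[OF x] unfolding backtracking_step_def by blast
  have bt: "\<alpha> t + s *\<^sub>R \<Delta> t \<in> \<Omega> \<and>
      F (\<alpha> t + s *\<^sub>R \<Delta> t) - Fo \<le> (1 - \<tau> * \<mu>\<^sub>B * (1 - \<gamma>) * s / 4) * (F (\<alpha> t) - Fo) \<and>
      1 - \<tau> * \<mu>\<^sub>B * (1 - \<gamma>) * s / 4 \<le> rate"
    if x: "\<alpha> t \<in> \<Omega>" and s: "backtracking_step g X \<xi> \<beta> \<tau> (\<alpha> t) (\<Delta> t) s" for t s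
  proof -
    obtain i where i: "s = \<beta> ^ i" "sufficient_decrease g X \<xi> \<tau> (\<alpha> t) (\<Delta> t) s"
        "\<forall>j<i. \<not> sufficient_decrease g X \<xi> \<tau> (\<alpha> t) (\<Delta> t) (\<beta> ^ j)"
      using s unfolding backtracking_step_def by blast
    have "min 1 (\<beta> * c) \<le> s"
      unfolding i(1) using backtracking_lower_bound[OF parameters(3,4) _ i(3)] iter(3)[OF x] suff[OF x] by blast
    then have 1: "1 - \<tau> * \<mu>\<^sub>B * (1 - \<gamma>) * s / 4 \<le> rate"
      unfolding rate_def c_def by (intro rate_bound parameters constants)
    have "s * \<tau> * pred t \<le> s * \<tau> * (- ((1 - \<gamma>) * \<mu>\<^sub>B * (F (\<alpha> t) - Fo) / 4))"
      using iter(2)[OF x] i(1) parameters by (intro mult_left_mono) auto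
    then have "F (\<alpha> t + s *\<^sub>R \<Delta> t) - Fo \<le> (1 - \<tau> * \<mu>\<^sub>B * (1 - \<gamma>) * s / 4) * (F (\<alpha> t) - Fo)"
      using i(2)[unfolded suff[OF x]] by (simp add: algebra_simps)
    then show ?thesis using 1 i(2)[unfolded suff[OF x]] by blast
  qed
  \<comment> \<open>The objective is \<infinity> off \<Omega>, so being no worse than a feasible
    trial makes the exact iterate feasible too.\<close>
  have exact: "\<alpha> (Suc t) \<in> \<Omega> \<and> F (\<alpha> (Suc t)) \<le> F (\<alpha> t + s *\<^sub>R \<Delta> t)"
    if "exact_step g X \<xi> (\<alpha> t) (\<Delta> t) (\<eta> t)" "\<alpha> t + s *\<^sub>R \<Delta> t \<in> \<Omega>" for t s
  proof -
    have "f (\<alpha> (Suc t)) \<le> f (\<alpha> t + s *\<^sub>R \<Delta> t)"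
      using that(1) unfolding exact_step_def f[symmetric] update by blast
    then show ?thesis using that(2) by (simp add: f_eq split: if_splits)
  qed
  have next_in: "\<alpha> (Suc t) \<in> \<Omega>" if x: "\<alpha> t \<in> \<Omega>" for t
    using step bt_ex[OF x] bt[OF x] exact unfolding update by blast
  have in_\<Omega>: "\<alpha> t \<in> \<Omega>" for t
    by (induction t) (use start next_in in auto)

  have ratio: "(f (\<alpha> (Suc t)) - fopt) / (f (\<alpha> t) - fopt) \<le> ereal k"
    if "F (\<alpha> (Suc t)) - Fo \<le> k * (F (\<alpha> t) - Fo)" "f (\<alpha> t) \<noteq> fopt" for t k
  proof -
    have "F (\<alpha> t) - Fo > 0" using that(2) Fo_le[OF in_\<Omega>[of t]] in_\<Omega>[of t] by (auto simp: f_eq Fo)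
    then show ?thesis using that(1) in_\<Omega> by (simp add: f_eq Fo pos_divide_le_eq)
  qed
  have contraction: "F (\<alpha> (Suc t)) - Fo \<le> rate * (F (\<alpha> t) - Fo)" for t
  proof -
    have mono: "(1 - \<tau> * \<mu>\<^sub>B * (1 - \<gamma>) * s / 4) * (F (\<alpha> t) - Fo) \<le> rate * (F (\<alpha> t) - Fo)"
      if "1 - \<tau> * \<mu>\<^sub>B * (1 - \<gamma>) * s / 4 \<le> rate" for s
      using that Fo_le[OF in_\<Omega>[of t]] by (intro mult_right_mono) auto
    from step show ?thesis
    proof
      assume "\<forall>t. backtracking_step g X \<xi> \<beta> \<tau> (\<alpha> t) (\<Delta> t) (\<eta> t)"
      then show ?thesis using bt[OF in_\<Omega>[of t], of "\<eta> t"] mono unfolding update by fastforce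
    next
      assume e: "\<forall>t. exact_step g X \<xi> (\<alpha> t) (\<Delta> t) (\<eta> t)"
      obtain s where "backtracking_step g X \<xi> \<beta> \<tau> (\<alpha> t) (\<Delta> t) s" using bt_ex[OF in_\<Omega>] by blast
      then show ?thesis using bt[OF in_\<Omega>[of t]] mono exact[of t s] e by fastforce
    qed
  qed
  \<comment> \<open>\<open>q_linear\<close> requires a factor in [0, 1):
    \<open>\<mu>\<^sub>B \<le> 2\<close> and a minimum of at most 1/2 keep it nonnegative, and
    positivity of the minimum keeps it below 1.\<close>
  have "0 \<le> rate \<and> rate < 1"
  proof -
    define k where "k = min ((1 - \<gamma>) / 2) (\<beta> * (1 - \<tau>) * (1 - sqrt \<gamma>) / L\<^sub>B)"
    have "k \<le> (1 - \<gamma>) / 2" unfolding k_def by (rule min.cobounded1)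
    then have k: "k \<le> 1 / 2" "0 < k" using parameters constants by (simp, simp add: k_def)
    have "\<tau> * (\<mu>\<^sub>B / 2) \<le> 1 * 1" using parameters constants by (intro mult_mono) auto
    then have "\<tau> * (\<mu>\<^sub>B / 2) * k \<le> 1 * 1" using k by (intro mult_mono) auto
    moreover have "0 < \<tau> * (\<mu>\<^sub>B / 2) * k" using k parameters constants by simp
    ultimately show ?thesis unfolding rate_def k_def[symmetric] by simp
  qed
  then have "q_linear (\<lambda>t. ereal (F (\<alpha> t))) (ereal Fo)"
    using contraction Fo_le[OF in_\<Omega>] by (intro q_linear_ereal) auto
  then have 1: "q_linear (\<lambda>t. f (\<alpha> t)) fopt" using in_\<Omega> by (simp add: f_eq Fo)
  have 2: "(f (\<alpha> t) \<noteq> fopt \<longrightarrow>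
        (f (\<alpha> (Suc t)) - fopt) / (f (\<alpha> t) - fopt) \<le> ereal (1 - \<tau> * \<mu>\<^sub>B * (1 - \<gamma>) * \<eta> t / 4))
      \<and> 1 - \<tau> * \<mu>\<^sub>B * (1 - \<gamma>) * \<eta> t / 4 \<le> rate"
    if "backtracking_step g X \<xi> \<beta> \<tau> (\<alpha> t) (\<Delta> t) (\<eta> t)" for t
    using bt[OF in_\<Omega> that] ratio[of t] unfolding update by blast
  have 3: "\<exists>s. backtracking_step g X \<xi> \<beta> \<tau> (\<alpha> t) (\<Delta> t) s \<and> (f (\<alpha> t) \<noteq> fopt \<longrightarrow>
        (f (\<alpha> (Suc t)) - fopt) / (f (\<alpha> t) - fopt) \<le> ereal (1 - \<tau> * \<mu>\<^sub>B * (1 - \<gamma>) * s / 4))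
      \<and> 1 - \<tau> * \<mu>\<^sub>B * (1 - \<gamma>) * s / 4 \<le> rate"
    if e: "exact_step g X \<xi> (\<alpha> t) (\<Delta> t) (\<eta> t)" for t
  proof -
    obtain s where s: "backtracking_step g X \<xi> \<beta> \<tau> (\<alpha> t) (\<Delta> t) s" using bt_ex[OF in_\<Omega>] by blast
    note b = bt[OF in_\<Omega> s]
    have "F (\<alpha> (Suc t)) - Fo \<le> (1 - \<tau> * \<mu>\<^sub>B * (1 - \<gamma>) * s / 4) * (F (\<alpha> t) - Fo)"
      using b exact[OF e, of s] by linarith
    then show ?thesis using s b ratio[of t] by blast
  qed
  show ?thesis using 1 2 3 unfolding rate_def by blast
qed

end
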